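(* Not every combinatorial $(n,k)$-hypersimplex is a facet of a combinatorial $(n+1,k+1)$-hypersimplex. That is, there exist integers $0<k<n$ and a combinatorial $(n,k)$-hypersimplex $Q$ such that no combinatorial $(n+1,k+1)$-hypersimplex has a facet affinely isomorphic to $Q$.
   Context: For integers $0<k<n$, $\Delta_{n,k}=\mathrm{conv}\{x\in\{0,1\}^n : x_1+\cdots+x_n=k\}$. A combinatorial $(n,k)$-hypersimplex is any polytope whose face lattice is isomorphic to the face lattice of $\Delta_{n,k}$. *)

theory Defs
  imports "HOL-Analysis.Analysis" "HOL-Analysis.Finite_Function_Topology"
begin

text \<open>
  All polytopes live in the space of finitely supported real sequences, the union of the
  spaces \<open>R^m\<close> (where \<open>R^m\<close> consists of the sequences supported on \<open>{..<m}\<close>).  A finite set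
  spans a finite-dimensional subspace, so its polytopes are, up to affine isomorphism,
  exactly the polytopes in some \<open>R^m\<close>, with no bound on \<open>m\<close>.  A single type is needed
  because \<open>n\<close> is existentially quantified in front of the polytopes, and the ambient
  dimensions depend on it.
\<close>

type_synonym rvec = "(nat, real) poly_mapping"

definition hypersimplex :: "nat \<Rightarrow> nat \<Rightarrow> rvec set" where
  "hypersimplex n k =
     convex hull {x. Poly_Mapping.keys x \<subseteq> {..<n}
                   \<and> (\<forall>i<n. Poly_Mapping.lookup x i \<in> {0, 1})
                   \<and> (\<Sum>i<n. Poly_Mapping.lookup x i) = real k}"

text \<open>The faces of \<open>S\<close> in the sense of \<open>face_of\<close> include \<open>{}\<close> and \<open>S\<close> itself.\<close>

definition face_lattices_isomorphic ::
    "'a::real_vector set \<Rightarrow> 'b::real_vector set \<Rightarrow> bool" where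
  "face_lattices_isomorphic S T \<longleftrightarrow>
     (\<exists>\<phi>. bij_betw \<phi> {F. F face_of S} {G. G face_of T} \<and>
          (\<forall>F F'. F face_of S \<longrightarrow> F' face_of S \<longrightarrow> (F \<subseteq> F' \<longleftrightarrow> \<phi> F \<subseteq> \<phi> F')))"

definition combinatorial_hypersimplex ::
    "nat \<Rightarrow> nat \<Rightarrow> 'a::real_vector set \<Rightarrow> bool" where
  "combinatorial_hypersimplex n k P \<longleftrightarrow>
     polytope P \<and> face_lattices_isomorphic P (hypersimplex n k)"

text \<open>
  The library's \<open>aff_dim\<close> and \<open>facet_of\<close> are restricted to Euclidean spaces.  The following
  are their counterparts for arbitrary real vector spaces; they agree with the library
  notions on Euclidean spaces (lemmas \<open>affine_dim_eq_aff_dim\<close> and \<open>is_facet_iff_facet_of\<close>).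
\<close>

definition affine_dim :: "'a::real_vector set \<Rightarrow> int" where
  "affine_dim S = (if S = {} then - 1 else int (dim {x - y |x y. x \<in> S \<and> y \<in> S}))"

definition is_facet :: "'a::real_vector set \<Rightarrow> 'a set \<Rightarrow> bool" where
  "is_facet F S \<longleftrightarrow> F face_of S \<and> F \<noteq> {} \<and> affine_dim F = affine_dim S - 1"

definition affinely_isomorphic ::
    "'a::real_vector set \<Rightarrow> 'b::real_vector set \<Rightarrow> bool" where
  "affinely_isomorphic S T \<longleftrightarrow> (\<exists>f c. linear f \<and> bij_betw (\<lambda>x. f x + c) S T)"

lemma affine_dim_eq_aff_dim: "affine_dim S = aff_dim S"
  for S :: "'a::euclidean_space set"
proof (cases "S = {}")
  case True
  then show ?thesis by (simp add: affine_dim_def)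
next
  case False
  then obtain a where a: "a \<in> S" by blast
  let ?D = "{x - y |x y. x \<in> S \<and> y \<in> S}" and ?T = "(+) (- a) ` S"
  have "?T \<subseteq> ?D"
  proof clarify
    fix x assume "x \<in> S"
    then show "\<exists>u v. - a + x = u - v \<and> u \<in> S \<and> v \<in> S"
      using a by (intro exI[of _ x] exI[of _ a]) simp
  qed
  moreover have "?D \<subseteq> span ?T"
  proof clarify
    fix x y assume "x \<in> S" "y \<in> S"
    then have "(- a + x) - (- a + y) \<in> span ?T"
      by (intro span_diff span_base) auto
    then show "x - y \<in> span ?T" by simp
  qed
  ultimately have "dim ?T \<le> dim ?D" "dim ?D \<le> dim (span ?T)"
    by (simp_all only: dim_subset)
  then have "dim ?D = dim ?T"
    by (simp only: dim_span)
  moreover have "aff_dim S = int (dim ?T)"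
    by (rule aff_dim_eq_dim[OF hull_inc[OF a]])
  ultimately show ?thesis
    using False by (simp add: affine_dim_def)
qed

lemma is_facet_iff_facet_of: "is_facet F S \<longleftrightarrow> F facet_of S"
  for F S :: "'a::euclidean_space set"
  by (simp add: is_facet_def facet_of_def affine_dim_eq_aff_dim)

end

theory Submission
  imports Defs
begin

text \<open>
  Choose positive weights with \<open>\<alpha> i j + \<alpha> j i = 2\<close>.  Placing the point
  \<open>\<alpha> i j e\<^sub>i + \<alpha> j i e\<^sub>j\<close> on each edge of a simplex in \<open>R^n\<close> yields a combinatorial
  \<open>(n,2)\<close>-hypersimplex, so these polytopes have many moduli.  Suppose that for \<open>n = 6\<close> such a
  polytope is a facet of a combinatorial \<open>(7,3)\<close>-hypersimplex \<open>P\<close>.  Up to relabelling it is the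
  facet \<open>x\<^sub>z = 1\<close>.  Let \<open>h\<^sub>i\<close> and \<open>g\<^sub>i\<close> be affine functions on \<open>P\<close> supporting the faces \<open>x\<^sub>i = 0\<close>
  and \<open>x\<^sub>i = 1\<close>.  The six functions \<open>h\<^sub>i\<close> with \<open>i \<noteq> z\<close> together with \<open>g\<^sub>z\<close> are coordinates on the
  affine hull of \<open>P\<close>.  In them the restriction of \<open>g\<^sub>i\<close> to the facet is prescribed by the
  weights, so \<open>g\<^sub>i\<close> is known up to one coefficient \<open>\<gamma>\<^sub>i\<close>, and \<open>h\<^sub>z\<close> has coefficients \<open>u\<^sub>i\<close> and \<open>- C\<close>.
  Each vertex of \<open>P\<close> off the facet lies on four of these hyperplanes, so every triple of indices
  yields an equation between \<open>\<gamma>\<close>, \<open>u\<close> and \<open>C\<close>.  These are 20 equations in 13 unknowns, and they are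
  inconsistent as soon as the weights on the edges \<open>01\<close> and \<open>12\<close> are tilted and all others equal 1.
\<close>

section \<open>Affine functions and face lattices\<close>

definition affine_fun :: "('a::real_vector \<Rightarrow> real) \<Rightarrow> bool" where
  "affine_fun \<phi> \<longleftrightarrow> (\<exists>f c. linear f \<and> \<phi> = (\<lambda>x. f x + c))"

lemma affine_fun_comb:
  assumes "affine_fun \<phi>" "u + v = 1"
  shows "\<phi> (u *\<^sub>R x + v *\<^sub>R y) = u * \<phi> x + v * \<phi> y"
proof -
  obtain f c where f: "linear f" and \<phi>: "\<phi> = (\<lambda>x. f x + c)"
    using assms(1) by (auto simp: affine_fun_def)
  have "c = u * c + v * c"
    using assms(2) by (metis distrib_right mult_1)
  then show ?thesis
    by (simp add: \<phi> linear_add[OF f] linear_cmul[OF f] distrib_left)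
qed

lemma affine_fun_sum:
  assumes "affine_fun \<phi>" "sum u V = 1"
  shows "\<phi> (\<Sum>v\<in>V. u v *\<^sub>R v) = (\<Sum>v\<in>V. u v * \<phi> v)"
proof -
  obtain f c where f: "linear f" and \<phi>: "\<phi> = (\<lambda>x. f x + c)"
    using assms(1) by (auto simp: affine_fun_def)
  have "(\<Sum>v\<in>V. u v * c) = c"
    by (simp add: assms(2) flip: sum_distrib_right)
  then show ?thesis
    by (simp add: \<phi> linear_sum[OF f] linear_cmul[OF f] distrib_left sum.distrib)
qed

lemma affine_fun_const [intro]: "affine_fun (\<lambda>x. c)"
  unfolding affine_fun_def by (rule exI[of _ "\<lambda>x. 0"]) (auto simp: linear_zero)

lemma affine_fun_add [intro]:
  assumes "affine_fun \<phi>" "affine_fun \<psi>"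
  shows "affine_fun (\<lambda>x. \<phi> x + \<psi> x)"
proof -
  obtain f c g d where "linear f" "\<phi> = (\<lambda>x. f x + c)" "linear g" "\<psi> = (\<lambda>x. g x + d)"
    using assms by (auto simp: affine_fun_def)
  then show ?thesis
    unfolding affine_fun_def
    by (intro exI[of _ "\<lambda>x. f x + g x"] exI[of _ "c + d"]) (auto intro: linear_compose_add)
qed

lemma affine_fun_mult [intro]:
  assumes "affine_fun \<phi>"
  shows "affine_fun (\<lambda>x. k * \<phi> x)"
proof -
  obtain f c where "linear f" "\<phi> = (\<lambda>x. f x + c)"
    using assms by (auto simp: affine_fun_def)
  then show ?thesis
    unfolding affine_fun_def
    by (intro exI[of _ "\<lambda>x. k * f x"] exI[of _ "k * c"])
       (auto simp: distrib_left intro!: linearI simp: linear_add linear_cmul)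
qed

lemma affine_fun_diff [intro]:
  assumes "affine_fun \<phi>" "affine_fun \<psi>"
  shows "affine_fun (\<lambda>x. \<phi> x - \<psi> x)"
  using affine_fun_add[OF assms(1) affine_fun_mult[OF assms(2), of "-1"]] by simp

lemma affine_fun_sum_fun [intro]:
  assumes "\<And>i. i \<in> I \<Longrightarrow> affine_fun (\<phi> i)"
  shows "affine_fun (\<lambda>x. \<Sum>i\<in>I. \<phi> i x)"
  using assms by (induction I rule: infinite_finite_induct) auto

lemma affine_fun_zero_hull:
  assumes "affine_fun \<phi>" "\<And>x. x \<in> S \<Longrightarrow> \<phi> x = 0" "y \<in> affine hull S"
  shows "\<phi> y = 0"
proof -
  have "affine hull S \<subseteq> {x. \<phi> x = 0}"
    by (rule hull_minimal) (use assms in \<open>auto simp: affine_def affine_fun_comb\<close>)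
  then show ?thesis using assms(3) by auto
qed

lemma face_of_affine_fun_zero:
  assumes "convex P" "affine_fun \<phi>" "\<And>x. x \<in> P \<Longrightarrow> 0 \<le> \<phi> x"
  shows "{x \<in> P. \<phi> x = 0} face_of P"
  unfolding face_of_def
proof (intro conjI ballI impI)
  show "convex {x \<in> P. \<phi> x = 0}"
    using assms(1,2) by (auto simp: convex_def affine_fun_comb)
next
  fix a b x
  assume ab: "a \<in> P" "b \<in> P" and x: "x \<in> {x \<in> P. \<phi> x = 0}" "x \<in> open_segment a b"
  obtain u where u: "0 < u" "u < 1" "x = (1 - u) *\<^sub>R a + u *\<^sub>R b"
    using x(2) by (auto simp: in_segment)
  have "(1 - u) * \<phi> a + u * \<phi> b = 0"
    using x u affine_fun_comb[OF assms(2), of "1 - u" u a b] by simp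
  moreover have "0 \<le> (1 - u) * \<phi> a" "0 \<le> u * \<phi> b"
    using u ab assms(3) by simp_all
  ultimately have "(1 - u) * \<phi> a = 0" "u * \<phi> b = 0"
    by linarith+
  then show "a \<in> {x \<in> P. \<phi> x = 0}" "b \<in> {x \<in> P. \<phi> x = 0}"
    using u ab by auto
qed auto

text \<open>Double description: a hull of finitely many points that is also cut out of an affine set
  by finitely many inequalities. With both at hand, faces can be read off from the incidences
  \<open>l j (p i) = 0\<close>. The points are indexed so that two polytopes can be compared over
  common index sets.\<close>

locale described_polytope =
  fixes I :: "'i set" and J :: "'j set" and p :: "'i \<Rightarrow> 'a::real_vector"
    and l :: "'j \<Rightarrow> 'a \<Rightarrow> real" and A :: "'a set"
  assumes fin: "finite I" "finite J"
    and aff: "affine A" "\<And>j. j \<in> J \<Longrightarrow> affine_fun (l j)"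
    and hull_eq: "convex hull (p ` I) = {x \<in> A. \<forall>j\<in>J. 0 \<le> l j x}"
begin

abbreviation "P \<equiv> convex hull (p ` I)"

definition zero_face where "zero_face K = {x \<in> P. \<forall>j\<in>K. l j x = 0}"
definition tight where "tight K = {i \<in> I. \<forall>j\<in>K. l j (p i) = 0}"

lemma nonneg: "x \<in> P \<Longrightarrow> j \<in> J \<Longrightarrow> 0 \<le> l j x"
  using hull_eq by auto

lemma p_in: "i \<in> I \<Longrightarrow> p i \<in> P"
  by (simp add: hull_inc)

lemma zero_face_face_of:
  assumes "K \<subseteq> J"
  shows "zero_face K face_of P"
proof -
  have "finite K" using assms fin(2) finite_subset by blast
  then show ?thesis using assms
  proof (induction K)
    case empty
    then show ?case by (simp add: zero_face_def face_of_refl)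
  next
    case (insert j K)
    have "zero_face (insert j K) = zero_face K \<inter> {x \<in> P. l j x = 0}"
      by (auto simp: zero_face_def)
    moreover have "{x \<in> P. l j x = 0} face_of P"
      using insert aff(2) nonneg by (intro face_of_affine_fun_zero) auto
    ultimately show ?case using insert by (simp add: face_of_Int)
  qed
qed

text \<open>A point of the zero face is a convex combination of the \<open>p i\<close>. Each
  \<open>l j\<close> with \<open>j\<close> in \<open>K\<close> is nonnegative on these points and
  averages to 0, so all weight sits on tight points.\<close>

lemma zero_face_hull:
  assumes "K \<subseteq> J"
  shows "zero_face K = convex hull (p ` tight K)"
proof
  show "convex hull (p ` tight K) \<subseteq> zero_face K"
    using face_of_imp_convex[OF zero_face_face_of[OF assms]] p_in
    by (intro hull_minimal) (auto simp: zero_face_def tight_def)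
next
  show "zero_face K \<subseteq> convex hull (p ` tight K)"
  proof
    fix x assume x: "x \<in> zero_face K"
    let ?V = "p ` I"
    have "x \<in> convex hull ?V" using x by (simp add: zero_face_def)
    then obtain u where u: "\<forall>v\<in>?V. 0 \<le> u v" "sum u ?V = 1" "(\<Sum>v\<in>?V. u v *\<^sub>R v) = x"
      using fin(1) by (auto simp: convex_hull_finite)
    have u0: "u v = 0" if v: "v \<in> ?V - p ` tight K" for v
    proof -
      obtain i where i: "i \<in> I" "v = p i" "i \<notin> tight K" using v by auto
      then obtain j where j: "j \<in> K" "l j v \<noteq> 0" by (auto simp: tight_def)
      then have jJ: "j \<in> J" using assms by auto
      have "(\<Sum>v\<in>?V. u v * l j v) = 0"
        using affine_fun_sum[OF aff(2)[OF jJ] u(2)] u(3) x j by (simp add: zero_face_def)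
      moreover have "0 \<le> u w * l j w" if "w \<in> ?V" for w
        using that u(1) jJ nonneg by (auto simp: hull_inc)
      ultimately have "\<forall>w\<in>?V. u w * l j w = 0"
        using fin(1) by (subst (asm) sum_nonneg_eq_0_iff) auto
      then show ?thesis using i j by auto
    qed
    have sub: "p ` tight K \<subseteq> ?V" by (auto simp: tight_def)
    have fint: "finite (p ` tight K)" using sub fin(1) finite_subset by blast
    have "sum u (p ` tight K) = 1"
      using sum.mono_neutral_right[of ?V "p ` tight K" u] u0 sub fin(1) u(2) by auto
    moreover have "(\<Sum>v\<in>p ` tight K. u v *\<^sub>R v) = x"
      using sum.mono_neutral_right[of ?V "p ` tight K" "\<lambda>v. u v *\<^sub>R v"] u0 sub fin(1) u(3) by auto
    moreover have "\<forall>v\<in>p ` tight K. 0 \<le> u v" using u(1) sub by blast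
    ultimately show "x \<in> convex hull (p ` tight K)"
      unfolding convex_hull_finite[OF fint] by blast
  qed
qed

text \<open>\<open>K\<close> collects the constraints that vanish on all of \<open>F\<close>. Some
  point \<open>x\<close> of \<open>F\<close> satisfies the others strictly, and a segment from any
  \<open>z\<close> of the zero face can be prolonged a little beyond \<open>x\<close> within the
  polytope, so the face property puts \<open>z\<close> into \<open>F\<close>.\<close>

lemma face_is_zero_face:
  assumes F: "F face_of P" "F \<noteq> {}"
  obtains K where "K \<subseteq> J" "F = zero_face K"
proof
  define K where "K = {j \<in> J. \<forall>x\<in>F. l j x = 0}"
  show "K \<subseteq> J" by (auto simp: K_def)
  have FP: "F \<subseteq> P" using F(1) by (rule face_of_imp_subset)
  have conv: "convex F" using F(1) by (rule face_of_imp_convex)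
  \<comment> \<open>A midpoint inherits every strict inequality of either endpoint, so strict
    constraints are gathered one at a time.\<close>
  have "\<exists>x\<in>F. \<forall>j\<in>M. 0 < l j x" if "finite M" "M \<subseteq> J - K" for M
    using that
  proof (induction M)
    case empty
    then show ?case using F(2) by auto
  next
    case (insert j M)
    then obtain x where x: "x \<in> F" "\<forall>j\<in>M. 0 < l j x" by auto
    obtain y where y: "y \<in> F" "l j y \<noteq> 0" using insert.prems by (auto simp: K_def)
    let ?z = "(1/2) *\<^sub>R x + (1/2) *\<^sub>R y"
    have "?z \<in> F" using convexD[OF conv x(1) y(1), of "1/2" "1/2"] by simp
    moreover have "0 < l i ?z" if "i \<in> insert j M" for i
    proof -
      have iJ: "i \<in> J" using that insert.prems by auto
      have "0 \<le> l i x" "0 \<le> l i y" using iJ x y FP nonneg by auto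
      moreover have "0 < l i x \<or> 0 < l i y"
        using that x y \<open>0 \<le> l i y\<close> by force
      ultimately show ?thesis
        using affine_fun_comb[OF aff(2)[OF iJ], of "1/2" "1/2" x y] by auto
    qed
    ultimately show ?case by blast
  qed
  then obtain x where x: "x \<in> F" "\<forall>j\<in>J - K. 0 < l j x"
    using fin(2) by (metis Diff_subset finite_subset order_refl)
  have "z \<in> F" if z: "z \<in> zero_face K" for z
  proof (cases "z = x")
    case False
    have zP: "z \<in> P" using z by (simp add: zero_face_def)
    \<comment> \<open>Bounds how far the segment may pass \<open>x\<close>: a minimum of finitely
      many ratios, with \<open>+ 1\<close> in the denominators because \<open>l j z\<close> may be
      0.\<close>
    have "\<exists>e>0. \<forall>j\<in>M. e * l j z \<le> l j x" if "finite M" "M \<subseteq> J - K" for M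
      using that
    proof (induction M)
      case empty
      then show ?case by (auto intro: exI[of _ 1])
    next
      case (insert j M)
      then obtain e where e: "e > 0" "\<forall>j\<in>M. e * l j z \<le> l j x" by auto
      have lx: "0 < l j x" and lz: "0 \<le> l j z" using insert.prems x(2) zP nonneg by auto
      let ?d = "min e (l j x / (l j z + 1))"
      have "?d > 0" using e lx lz by simp
      moreover have "?d * l i z \<le> l i x" if "i \<in> insert j M" for i
      proof (cases "i = j")
        case True
        have "?d * l j z \<le> l j x / (l j z + 1) * l j z"
          using lz by (intro mult_right_mono) auto
        also have "\<dots> \<le> l j x" using lx lz by (simp add: field_simps)
        finally show ?thesis using True by simp
      next
        case False
        then have "0 \<le> l i z" "e * l i z \<le> l i x"
          using that insert.prems e zP nonneg by auto
        then show ?thesis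
          by (meson min.cobounded1 mult_right_mono order_trans)
      qed
      ultimately show ?case by blast
    qed
    then obtain e where e: "e > 0" "\<forall>j\<in>J - K. e * l j z \<le> l j x"
      using fin(2) by (metis Diff_subset finite_subset order_refl)
    define w where "w = (1 + e) *\<^sub>R x + (- e) *\<^sub>R z"
    have "w \<in> A"
      using aff(1) x(1) FP zP hull_eq unfolding w_def by (intro mem_affine) auto
    moreover have "0 \<le> l j w" if j: "j \<in> J" for j
    proof -
      have lw: "l j w = (1 + e) * l j x + (- e) * l j z"
        unfolding w_def using aff(2)[OF j] by (rule affine_fun_comb) simp
      show ?thesis
      proof (cases "j \<in> K")
        case True
        then show ?thesis using lw x(1) z by (auto simp: zero_face_def K_def)
      next
        case False
        then have "e * l j z \<le> l j x" "0 < l j x" using e x j by auto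
        moreover have "0 \<le> e * l j x" using e \<open>0 < l j x\<close> by simp
        ultimately show ?thesis by (simp add: lw distrib_right)
      qed
    qed
    ultimately have wP: "w \<in> P" using hull_eq by auto
    have "w - z = (1 + e) *\<^sub>R (x - z)" by (simp add: w_def algebra_simps)
    then have "w \<noteq> z" using False e(1) by auto
    moreover have "x = (1 - 1 / (1 + e)) *\<^sub>R z + (1 / (1 + e)) *\<^sub>R w"
      using e(1) by (simp add: w_def algebra_simps add_divide_distrib[symmetric] flip: scaleR_add_left)
    moreover have "0 < 1 / (1 + e)" "1 / (1 + e) < 1" using e(1) by auto
    ultimately have "x \<in> open_segment z w" unfolding in_segment by metis
    then show ?thesis using face_ofD[OF F(1)] zP wP x(1) by blast
  qed (use x in auto)
  moreover have "F \<subseteq> zero_face K" using FP by (auto simp: zero_face_def K_def)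
  ultimately show "F = zero_face K" by auto
qed

end

text \<open>A nonempty face is the hull of its tight points, and tight index sets depend on the
  incidences alone. Keeping the indices while exchanging \<open>p\<close> for \<open>q\<close> thus
  gives mutually inverse monotone maps on faces.\<close>

lemma face_lattices_isomorphic_of_incidence:
  assumes "described_polytope I J p l A" "described_polytope I J q m B"
    and inc: "\<And>i j. i \<in> I \<Longrightarrow> j \<in> J \<Longrightarrow> l j (p i) = 0 \<longleftrightarrow> m j (q i) = 0"
  shows "face_lattices_isomorphic (convex hull (p ` I)) (convex hull (q ` I))"
proof -
  interpret S: described_polytope I J p l A by fact
  interpret T: described_polytope I J q m B by fact
  define \<phi> where "\<phi> F = convex hull (q ` {i \<in> I. p i \<in> F})" for F
  define \<psi> where "\<psi> G = convex hull (p ` {i \<in> I. q i \<in> G})" for G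
  have tight: "S.tight K = T.tight K" if "K \<subseteq> J" for K
    using that inc by (auto simp: S.tight_def T.tight_def)
  have vs: "{i \<in> I. p i \<in> S.zero_face K} = S.tight K" "{i \<in> I. q i \<in> T.zero_face K} = T.tight K" for K
    by (auto simp: S.zero_face_def S.tight_def T.zero_face_def T.tight_def hull_inc)
  have \<phi>: "\<phi> (S.zero_face K) = T.zero_face K" and \<psi>: "\<psi> (T.zero_face K) = S.zero_face K"
    if "K \<subseteq> J" for K
    using that tight[OF that] S.zero_face_hull[OF that] T.zero_face_hull[OF that]
    unfolding \<phi>_def \<psi>_def vs by simp_all
  have \<phi>0: "\<phi> {} = {}" "\<psi> {} = {}" by (simp_all add: \<phi>_def \<psi>_def)
  have 1: "\<phi> F face_of T.P \<and> \<psi> (\<phi> F) = F" if F: "F face_of S.P" for F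
  proof (cases "F = {}")
    case False
    then obtain K where "K \<subseteq> J" "F = S.zero_face K"
      using S.face_is_zero_face[OF F] by blast
    then show ?thesis using T.zero_face_face_of by (simp add: \<phi> \<psi>)
  qed (simp add: \<phi>0)
  have 2: "\<psi> G face_of S.P \<and> \<phi> (\<psi> G) = G" if G: "G face_of T.P" for G
  proof (cases "G = {}")
    case False
    then obtain K where "K \<subseteq> J" "G = T.zero_face K"
      using T.face_is_zero_face[OF G] by blast
    then show ?thesis using S.zero_face_face_of by (simp add: \<phi> \<psi>)
  qed (simp add: \<phi>0)
  have mono: "\<phi> F \<subseteq> \<phi> F'" if "F \<subseteq> F'" for F F'
    unfolding \<phi>_def using that by (intro hull_mono) auto
  have mono': "\<psi> G \<subseteq> \<psi> G'" if "G \<subseteq> G'" for G G'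
    unfolding \<psi>_def using that by (intro hull_mono) auto
  have "bij_betw \<phi> {F. F face_of S.P} {G. G face_of T.P}"
    by (rule bij_betw_byWitness[where f' = \<psi>]) (use 1 2 in auto)
  moreover have "F \<subseteq> F' \<longleftrightarrow> \<phi> F \<subseteq> \<phi> F'" if "F face_of S.P" "F' face_of S.P" for F F'
    using mono[of F F'] mono'[of "\<phi> F" "\<phi> F'"] 1[OF that(1)] 1[OF that(2)] by auto
  ultimately show ?thesis unfolding face_lattices_isomorphic_def by blast
qed

section \<open>Points on the edges of a simplex\<close>

definition weighted_pair :: "(nat \<Rightarrow> nat \<Rightarrow> real) \<Rightarrow> nat \<times> nat \<Rightarrow> rvec" where
  "weighted_pair \<alpha> = (\<lambda>(i, j). Poly_Mapping.single i (\<alpha> i j) + Poly_Mapping.single j (\<alpha> j i))"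

text \<open>Ordered pairs: each edge of the simplex occurs twice, and both orders give the same
  point.\<close>

definition distinct_pairs :: "nat \<Rightarrow> (nat \<times> nat) set" where
  "distinct_pairs n = {(i, j). i < n \<and> j < n \<and> i \<noteq> j}"

text \<open>The analogue of the inequality \<open>x_i \<le> 1\<close>: for positive weights it
  vanishes at the generators through \<open>i\<close> and is positive at the others. For unit
  weights and coordinate sum 2 it equals \<open>2 - 2 * x_i\<close>.\<close>

definition slack :: "(nat \<Rightarrow> nat \<Rightarrow> real) \<Rightarrow> nat \<Rightarrow> nat \<Rightarrow> rvec \<Rightarrow> real" where
  "slack \<alpha> n i x = (\<Sum>j\<in>{..<n} - {i}. \<alpha> i j / \<alpha> j i * Poly_Mapping.lookup x j) - Poly_Mapping.lookup x i"

lemma lookup_scaleR: "Poly_Mapping.lookup (r *\<^sub>R x) i = r *\<^sub>R Poly_Mapping.lookup x i"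
proof -
  have "{i. r *\<^sub>R Poly_Mapping.lookup x i \<noteq> 0} \<subseteq> {i. Poly_Mapping.lookup x i \<noteq> 0}" by auto
  then have "finite {i. r *\<^sub>R Poly_Mapping.lookup x i \<noteq> 0}"
    using finite_lookup finite_subset by blast
  then show ?thesis by (simp add: scaleR_poly_mapping_def)
qed

lemma linear_lookup: "linear (\<lambda>x::rvec. Poly_Mapping.lookup x i)"
  by (rule linearI) (simp_all add: lookup_add lookup_scaleR)

lemma linear_slack: "linear (slack \<alpha> n i)"
proof (rule linearI)
  fix x y :: rvec and r :: real
  show "slack \<alpha> n i (x + y) = slack \<alpha> n i x + slack \<alpha> n i y"
    by (simp add: slack_def lookup_add distrib_left sum.distrib)
  show "slack \<alpha> n i (r *\<^sub>R x) = r *\<^sub>R slack \<alpha> n i x"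
    by (simp add: slack_def lookup_scaleR right_diff_distrib sum_distrib_left mult.left_commute)
qed

lemma lookup_weighted_pair:
  assumes "i \<noteq> j"
  shows "Poly_Mapping.lookup (weighted_pair \<alpha> (i, j)) k =
    (if k = i then \<alpha> i j else if k = j then \<alpha> j i else 0)"
  using assms by (simp add: weighted_pair_def lookup_add lookup_single when_def)

lemma keys_weighted_pair: "Poly_Mapping.keys (weighted_pair \<alpha> (i, j)) \<subseteq> {i, j}"
  by (auto simp: weighted_pair_def in_keys_iff lookup_add lookup_single when_def split: if_splits)

lemma slack_weighted_pair:
  assumes "i < n" "j < n" "i \<noteq> j" "\<alpha> i j \<noteq> 0" "\<alpha> j i \<noteq> 0"
  shows "slack \<alpha> n k (weighted_pair \<alpha> (i, j)) =
    (if k = i \<or> k = j then 0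
     else \<alpha> k i / \<alpha> i k * \<alpha> i j + \<alpha> k j / \<alpha> j k * \<alpha> j i)"
proof -
  let ?x = "weighted_pair \<alpha> (i, j)"
  have "(\<Sum>l\<in>{..<n} - {k}. \<alpha> k l / \<alpha> l k * Poly_Mapping.lookup ?x l)
      = (\<Sum>l\<in>{i, j} - {k}. \<alpha> k l / \<alpha> l k * Poly_Mapping.lookup ?x l)"
    using assms by (intro sum.mono_neutral_right) (auto simp: lookup_weighted_pair)
  then have "slack \<alpha> n k ?x = (\<Sum>l\<in>{i, j} - {k}. \<alpha> k l / \<alpha> l k * Poly_Mapping.lookup ?x l)
      - Poly_Mapping.lookup ?x k"
    by (simp add: slack_def)
  moreover have "{i, j} - {i} = {j}" "{i, j} - {j} = {i}"
    using assms by auto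
  moreover have "{i, j} - {k} = {i, j}" if "k \<noteq> i" "k \<noteq> j" using that by auto
  ultimately show ?thesis
    using assms by (cases "k = i"; cases "k = j") (simp_all add: lookup_weighted_pair)
qed

text \<open>\<open>e\<close> is the least ratio \<open>a k / b k\<close> over positive
  \<open>b k\<close>, as in the simplex method: the largest step that keeps all differences
  nonnegative, at which one of them becomes 0.\<close>

lemma ratio_test:
  fixes a b :: "'c \<Rightarrow> real"
  assumes "finite L" "\<And>k. k \<in> L \<Longrightarrow> 0 \<le> a k" "k0 \<in> L" "0 < b k0"
  obtains e k where "0 \<le> e" "k \<in> L" "a k - e * b k = 0" "\<And>k. k \<in> L \<Longrightarrow> 0 \<le> a k - e * b k"
proof -
  define R where "R = (\<lambda>k. a k / b k) ` {k \<in> L. 0 < b k}"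
  have R: "finite R" "R \<noteq> {}" using assms by (auto simp: R_def)
  obtain k where k: "k \<in> L" "0 < b k" "Min R = a k / b k"
    using Min_in[OF R] by (auto simp: R_def)
  show ?thesis
  proof (rule that[of "Min R" k])
    show e: "0 \<le> Min R" using k assms(2) by simp
    show "a k - Min R * b k = 0" using k by simp
    show "0 \<le> a l - Min R * b l" if l: "l \<in> L" for l
    proof (cases "0 < b l")
      case True
      then have "Min R \<le> a l / b l" using l R by (auto simp: R_def)
      then show ?thesis using True by (simp add: pos_le_divide_eq)
    next
      case False
      then have "Min R * b l \<le> 0" using e by (simp add: mult_nonneg_nonpos)
      then show ?thesis using assms(2)[OF l] by linarith
    qed
  qed (use k in auto)
qed

text \<open>Subtracting a suitable multiple of a generator from \<open>x\<close> either kills a coordinate or makes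
  a \<open>slack\<close> vanish; in the second case the remainder is an explicit combination of the generators
  through the corresponding index.\<close>

lemma cone_weighted_pairs:
  fixes \<alpha> :: "nat \<Rightarrow> nat \<Rightarrow> real"
  assumes \<alpha>: "\<And>i j. 0 < \<alpha> i j"
    and K: "0 \<in> K" "\<And>x y. x \<in> K \<Longrightarrow> y \<in> K \<Longrightarrow> x + y \<in> K"
      "\<And>c x. 0 \<le> c \<Longrightarrow> x \<in> K \<Longrightarrow> c *\<^sub>R x \<in> K"
      "\<And>i. i \<in> distinct_pairs n \<Longrightarrow> weighted_pair \<alpha> i \<in> K"
    and x: "Poly_Mapping.keys x \<subseteq> {..<n}" "\<And>i. 0 \<le> Poly_Mapping.lookup x i"
      "\<And>i. i < n \<Longrightarrow> 0 \<le> slack \<alpha> n i x"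
  shows "x \<in> K"
  using x
proof (induction "card (Poly_Mapping.keys x)" arbitrary: x rule: less_induct)
  case less
  have tight: "y \<in> K" if y: "i < n" "slack \<alpha> n i y = 0" "Poly_Mapping.keys y \<subseteq> {..<n}"
      "\<And>i. 0 \<le> Poly_Mapping.lookup y i" for y i
  proof -
    let ?N = "{..<n} - {i}"
    let ?g = "\<lambda>j. (Poly_Mapping.lookup y j / \<alpha> j i) *\<^sub>R weighted_pair \<alpha> (i, j)"
    \<comment> \<open>The coefficients are chosen to match each coordinate
      \<open>j \<noteq> i\<close>; coordinate \<open>i\<close> then matches because the slack at
      \<open>i\<close> vanishes.\<close>
    have yeq: "y = sum ?g ?N"
    proof (rule poly_mapping_eqI)
      fix k
      have l: "Poly_Mapping.lookup (?g j) k =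
          (if k = i then \<alpha> i j / \<alpha> j i * Poly_Mapping.lookup y j
           else if k = j then Poly_Mapping.lookup y j else 0)" if "j \<in> ?N" for j
        using that less_imp_neq[OF \<alpha>[of j i]] by (simp add: lookup_scaleR lookup_weighted_pair)
      have "Poly_Mapping.lookup (sum ?g ?N) k =
          (\<Sum>j\<in>?N. if k = i then \<alpha> i j / \<alpha> j i * Poly_Mapping.lookup y j
           else if k = j then Poly_Mapping.lookup y j else 0)"
        unfolding lookup_sum by (rule sum.cong) (auto simp only: l)
      also have "\<dots> = Poly_Mapping.lookup y k"
      proof (cases "k = i")
        case True
        then show ?thesis using y(2) by (simp add: slack_def)
      next
        case False
        then have "Poly_Mapping.lookup y k = 0" if "k \<notin> ?N"
          using that y(3) by (auto simp: in_keys_iff)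
        then show ?thesis using False by (auto simp: sum.delta)
      qed
      finally show "Poly_Mapping.lookup y k = Poly_Mapping.lookup (sum ?g ?N) k" by simp
    qed
    have sumK: "sum ?g M \<in> K" if "M \<subseteq> ?N" for M
      using finite_subset[OF that] that
    proof (induction M rule: infinite_finite_induct)
      case (insert j M)
      have "?g j \<in> K"
        using insert y \<alpha>[of j i] by (intro K) (auto simp: distinct_pairs_def)
      then show ?case using insert K by simp
    qed (use K in auto)
    show ?thesis by (subst yeq) (rule sumK[OF order_refl])
  qed
  show ?case
  proof (cases "Poly_Mapping.keys x = {}")
    case True
    then show ?thesis using K by simp
  next
    case False
    then obtain i where i: "i \<in> Poly_Mapping.keys x" by blast
    then have i': "i < n" "0 < Poly_Mapping.lookup x i"
      using less.prems(1) less.prems(2)[of i] by (auto simp: in_keys_iff)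
    \<comment> \<open>A nonnegative slack at a positive coordinate \<open>i\<close> forces a second
      positive coordinate \<open>j\<close>, which selects the generator to subtract.\<close>
    then have "0 < (\<Sum>j\<in>{..<n} - {i}. \<alpha> i j / \<alpha> j i * Poly_Mapping.lookup x j)"
      using less.prems(3)[of i] by (simp add: slack_def)
    then have "\<exists>j\<in>{..<n} - {i}. 0 < \<alpha> i j / \<alpha> j i * Poly_Mapping.lookup x j"
      by (meson linorder_not_le sum_nonpos)
    then obtain j where j: "j < n" "j \<noteq> i" "0 < \<alpha> i j / \<alpha> j i * Poly_Mapping.lookup x j"
      by blast
    let ?p = "weighted_pair \<alpha> (i, j)"
    \<comment> \<open>These are the quantities that the subtraction may make negative; coordinates
      other than \<open>i\<close> and \<open>j\<close> do not change.\<close>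
    define L where "L = {\<lambda>x::rvec. Poly_Mapping.lookup x i, \<lambda>x. Poly_Mapping.lookup x j}
        \<union> slack \<alpha> n ` {..<n}"
    have "finite L" by (simp add: L_def)
    moreover have "0 \<le> \<phi> x" if "\<phi> \<in> L" for \<phi> using that less.prems by (auto simp: L_def)
    moreover have "(\<lambda>x::rvec. Poly_Mapping.lookup x i) \<in> L" by (simp add: L_def)
    moreover have "0 < Poly_Mapping.lookup ?p i" using j \<alpha> by (simp add: lookup_weighted_pair)
    ultimately obtain e \<phi> where e: "0 \<le> e" "\<phi> \<in> L" "\<phi> x - e * \<phi> ?p = 0"
      "\<And>\<phi>. \<phi> \<in> L \<Longrightarrow> 0 \<le> \<phi> x - e * \<phi> ?p"
      using ratio_test[of L "\<lambda>\<phi>. \<phi> x" "\<lambda>x. Poly_Mapping.lookup x i" "\<lambda>\<phi>. \<phi> ?p"] by metis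
    define y where "y = x - e *\<^sub>R ?p"
    have lin: "linear \<phi>" if "\<phi> \<in> L" for \<phi>
      using that by (auto simp: L_def linear_lookup linear_slack)
    have \<phi>y: "\<phi> y = \<phi> x - e * \<phi> ?p" if "\<phi> \<in> L" for \<phi>
      by (simp add: y_def linear_diff[OF lin[OF that]] linear_cmul[OF lin[OF that]])
    have ly: "Poly_Mapping.lookup y k = Poly_Mapping.lookup x k" if "k \<noteq> i" "k \<noteq> j" for k
      using that j by (simp add: y_def lookup_minus lookup_scaleR lookup_weighted_pair)
    have "0 < Poly_Mapping.lookup x j"
      using j(3) less.prems(2)[of j] by (cases "Poly_Mapping.lookup x j = 0") auto
    then have keys: "Poly_Mapping.keys y \<subseteq> Poly_Mapping.keys x"
      using ly i'(2) by (auto simp: in_keys_iff) (metis less_irrefl)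
    have y0: "0 \<le> Poly_Mapping.lookup y k" for k
    proof (cases "k = i \<or> k = j")
      case True
      then have "(\<lambda>x::rvec. Poly_Mapping.lookup x k) \<in> L" by (auto simp: L_def)
      from e(4)[OF this] \<phi>y[OF this] show ?thesis by simp
    qed (use ly less.prems in auto)
    have yK: "y \<in> K"
    proof (cases "\<phi> \<in> slack \<alpha> n ` {..<n}")
      case True
      then show ?thesis using tight e \<phi>y y0 keys less.prems(1) by auto
    next
      case False
      then obtain k where k: "k = i \<or> k = j" "Poly_Mapping.lookup y k = 0"
        using e \<phi>y[OF e(2)] by (auto simp: L_def)
      then have "k \<in> Poly_Mapping.keys x - Poly_Mapping.keys y"
        using i \<open>0 < Poly_Mapping.lookup x j\<close> by (auto simp: in_keys_iff)
      then have "card (Poly_Mapping.keys y) < card (Poly_Mapping.keys x)"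
        using keys by (intro psubset_card_mono) auto
      moreover have "0 \<le> slack \<alpha> n l y" if "l < n" for l
        using that e(4)[of "slack \<alpha> n l"] \<phi>y[of "slack \<alpha> n l"] by (simp add: L_def)
      ultimately show ?thesis
        using less.hyps keys y0 less.prems(1) by blast
    qed
    have "e *\<^sub>R ?p \<in> K" using e i' j by (intro K) (auto simp: distinct_pairs_def)
    then have "y + e *\<^sub>R ?p \<in> K" using yK K by blast
    then show ?thesis by (simp add: y_def)
  qed
qed

text \<open>The flag is \<open>True\<close> for inequalities of type \<open>x_i \<ge> 0\<close> and
  \<open>False\<close> for those of type \<open>x_i \<le> 1\<close>.\<close>

definition pair_constraint :: "(nat \<Rightarrow> nat \<Rightarrow> real) \<Rightarrow> nat \<Rightarrow> bool \<times> nat \<Rightarrow> rvec \<Rightarrow> real" where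
  "pair_constraint \<alpha> n = (\<lambda>(b, i) x. if b then Poly_Mapping.lookup x i else slack \<alpha> n i x)"

text \<open>The generators satisfy the inequalities by computation. Conversely,
  \<open>cone_weighted_pairs\<close> makes a solution a nonnegative multiple of a point of the hull,
  and the common coordinate sum 2 forces the factor 1.\<close>

lemma described_weighted_pairs:
  fixes \<alpha> :: "nat \<Rightarrow> nat \<Rightarrow> real"
  assumes \<alpha>: "\<And>i j. 0 < \<alpha> i j" "\<And>i j. i < n \<Longrightarrow> j < n \<Longrightarrow> i \<noteq> j \<Longrightarrow> \<alpha> i j + \<alpha> j i = 2"
  shows "described_polytope (distinct_pairs n) (UNIV \<times> {..<n}) (weighted_pair \<alpha>)
    (pair_constraint \<alpha> n) {x. Poly_Mapping.keys x \<subseteq> {..<n} \<and> (\<Sum>i<n. Poly_Mapping.lookup x i) = 2}"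
    (is "described_polytope ?I ?J _ _ ?A")
proof
  show "finite ?I"
    by (rule finite_subset[of _ "{..<n} \<times> {..<n}"]) (auto simp: distinct_pairs_def)
  show "finite ?J" by simp
  have "?A = {x. \<forall>i. i \<ge> n \<longrightarrow> Poly_Mapping.lookup x i = 0} \<inter> {x. (\<Sum>i<n. Poly_Mapping.lookup x i) = 2}"
    by (auto simp: in_keys_iff) (meson not_less)
  then show affA: "affine ?A"
    by (auto simp: affine_def lookup_add lookup_scaleR sum.distrib simp flip: sum_distrib_left distrib_right)
  show "affine_fun (pair_constraint \<alpha> n j)" for j
  proof (cases j)
    case (Pair b i)
    then have "linear (pair_constraint \<alpha> n j)"
      by (cases b) (simp_all add: pair_constraint_def linear_lookup linear_slack)
    then show ?thesis
      unfolding affine_fun_def by (intro exI[of _ "pair_constraint \<alpha> n j"] exI[of _ 0]) simp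
  qed
  then have aff: "affine_fun (pair_constraint \<alpha> n j)" for j .
  let ?P = "{x \<in> ?A. \<forall>j\<in>?J. 0 \<le> pair_constraint \<alpha> n j x}"
  let ?H = "convex hull (weighted_pair \<alpha> ` ?I)"
  have nz: "\<alpha> i j \<noteq> 0" for i j using \<alpha>(1)[of i j] by simp
  have gen: "weighted_pair \<alpha> q \<in> ?P" if "q \<in> ?I" for q
  proof -
    from that obtain i j where q: "q = (i, j)" "i < n" "j < n" "i \<noteq> j"
      by (auto simp: distinct_pairs_def)
    have "(\<Sum>k<n. Poly_Mapping.lookup (weighted_pair \<alpha> q) k) =
       (\<Sum>k\<in>{i, j}. Poly_Mapping.lookup (weighted_pair \<alpha> q) k)"
      using q by (intro sum.mono_neutral_right) (auto simp: lookup_weighted_pair)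
    then have "(\<Sum>k<n. Poly_Mapping.lookup (weighted_pair \<alpha> q) k) = 2"
      using q \<alpha>(2)[of i j] by (simp add: lookup_weighted_pair)
    moreover have "Poly_Mapping.keys (weighted_pair \<alpha> q) \<subseteq> {..<n}"
      using keys_weighted_pair[of \<alpha> i j] q by auto
    moreover have "0 \<le> pair_constraint \<alpha> n (b, k) (weighted_pair \<alpha> q)" for b k
      using q \<alpha>(1) less_imp_le[OF \<alpha>(1)] nz
      by (auto simp: pair_constraint_def lookup_weighted_pair slack_weighted_pair
          intro!: add_nonneg_nonneg)
    ultimately show ?thesis by auto
  qed
  have "convex ?A" using affA by (rule affine_imp_convex)
  moreover have "convex {x. 0 \<le> pair_constraint \<alpha> n j x}" for j
    by (auto simp: convex_def affine_fun_comb[OF aff])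
  ultimately have "convex (?A \<inter> (\<Inter>j\<in>?J. {x. 0 \<le> pair_constraint \<alpha> n j x}))"
    by (intro convex_Int convex_INT) auto
  moreover have "?P = ?A \<inter> (\<Inter>j\<in>?J. {x. 0 \<le> pair_constraint \<alpha> n j x})" by blast
  ultimately have "convex ?P" by simp
  then have "?H \<subseteq> ?P" using gen by (intro hull_minimal image_subsetI)
  moreover have "?P \<subseteq> ?H"
  proof
    fix x assume x: "x \<in> ?P"
    \<comment> \<open>The cone over the hull. Adding 0 by hand covers \<open>n < 2\<close>, where
      the hull is empty.\<close>
    define K where "K = {c *\<^sub>R y |c y. 0 \<le> c \<and> y \<in> ?H} \<union> {0}"
    have conv: "convex ?H" by simp
    have "x \<in> K"
    proof (rule cone_weighted_pairs[where \<alpha> = \<alpha> and K = K and n = n])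
      show "0 < \<alpha> i j" for i j by (rule \<alpha>(1))
      show "0 \<in> K" by (simp add: K_def)
      show "c *\<^sub>R y \<in> K" if "0 \<le> c" "y \<in> K" for c y
        using that by (auto simp: K_def) (metis mult_nonneg_nonneg)
      show "weighted_pair \<alpha> i \<in> K" if "i \<in> ?I" for i
      proof -
        have "weighted_pair \<alpha> i = 1 *\<^sub>R weighted_pair \<alpha> i" by simp
        moreover have "weighted_pair \<alpha> i \<in> ?H" using that by (simp add: hull_inc)
        ultimately show ?thesis unfolding K_def by (metis (mono_tags, lifting) UnI1 mem_Collect_eq zero_le_one)
      qed
      show "v + w \<in> K" if v: "v \<in> K" and w: "w \<in> K" for v w
      proof (cases "v = 0 \<or> w = 0")
        case False
        then obtain c y d z where e: "v = c *\<^sub>R y" "0 < c" "y \<in> ?H" "w = d *\<^sub>R z" "0 < d" "z \<in> ?H"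
          using v w by (auto simp: K_def)
        have "(c / (c + d)) *\<^sub>R y + (d / (c + d)) *\<^sub>R z \<in> ?H"
          using e by (intro convexD[OF conv]) (auto simp flip: add_divide_distrib)
        moreover have "v + w = (c + d) *\<^sub>R ((c / (c + d)) *\<^sub>R y + (d / (c + d)) *\<^sub>R z)"
          using e by (simp add: scaleR_add_right)
        ultimately show ?thesis
          unfolding K_def using e(2,5) by (metis (mono_tags, lifting) UnI1 mem_Collect_eq add_nonneg_nonneg less_imp_le)
      qed (use v w in auto)
      show "Poly_Mapping.keys x \<subseteq> {..<n}" using x by auto
      show "0 \<le> Poly_Mapping.lookup x i" for i
      proof (cases "i < n")
        case True
        then have "(True, i) \<in> ?J" by simp
        then have "0 \<le> pair_constraint \<alpha> n (True, i) x" using x by blast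
        then show ?thesis by (simp add: pair_constraint_def)
      next
        case False
        then have "i \<notin> Poly_Mapping.keys x" using x by auto
        then show ?thesis by (simp add: in_keys_iff)
      qed
      show "0 \<le> slack \<alpha> n i x" if "i < n" for i
      proof -
        have "(False, i) \<in> ?J" using that by simp
        then have "0 \<le> pair_constraint \<alpha> n (False, i) x" using x by blast
        then show ?thesis by (simp add: pair_constraint_def)
      qed
    qed
    moreover have "(\<Sum>i<n. Poly_Mapping.lookup x i) = 2" using x by blast
    ultimately obtain c y where c: "x = c *\<^sub>R y" "y \<in> ?H"
      by (auto simp: K_def)
    then have "(\<Sum>i<n. Poly_Mapping.lookup y i) = 2" using \<open>?H \<subseteq> ?P\<close> by blast
    moreover have "(\<Sum>i<n. Poly_Mapping.lookup x i) = c * (\<Sum>i<n. Poly_Mapping.lookup y i)"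
      by (simp add: c lookup_scaleR sum_distrib_left)
    ultimately have "c = 1" using \<open>(\<Sum>i<n. Poly_Mapping.lookup x i) = 2\<close> by simp
    then show "x \<in> ?H" using c by simp
  qed
  ultimately show "?H = ?P" by blast
qed

section \<open>The standard hypersimplex as a hull of indicator vectors\<close>

definition hypersimplex_vertices :: "nat \<Rightarrow> nat \<Rightarrow> nat set set" where
  "hypersimplex_vertices n k = {S. S \<subseteq> {..<n} \<and> card S = k}"

definition indicator_vec :: "nat set \<Rightarrow> rvec" where
  "indicator_vec S = (\<Sum>i\<in>S. Poly_Mapping.single i 1)"

lemma lookup_indicator_vec:
  "finite S \<Longrightarrow> Poly_Mapping.lookup (indicator_vec S) i = (if i \<in> S then 1 else 0)"
  by (simp add: indicator_vec_def lookup_sum lookup_single when_def)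

lemma hypersimplex_vertices_finite: "S \<in> hypersimplex_vertices n k \<Longrightarrow> finite S"
  by (auto simp: hypersimplex_vertices_def intro: finite_subset)

lemma hypersimplex_eq_hull:
  "hypersimplex n k = convex hull (indicator_vec ` hypersimplex_vertices n k)"
proof -
  have "{x. Poly_Mapping.keys x \<subseteq> {..<n} \<and> (\<forall>i<n. Poly_Mapping.lookup x i \<in> {0, 1})
      \<and> (\<Sum>i<n. Poly_Mapping.lookup x i) = real k} = indicator_vec ` hypersimplex_vertices n k"
    (is "?S = ?T")
  proof
    show "?S \<subseteq> ?T"
    proof
      fix x assume x: "x \<in> ?S"
      define M where "M = {i. i < n \<and> Poly_Mapping.lookup x i = 1}"
      have fin: "finite M" by (simp add: M_def)
      have "(\<Sum>i<n. Poly_Mapping.lookup x i) = (\<Sum>i\<in>M. Poly_Mapping.lookup x i)"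
        using x by (intro sum.mono_neutral_right) (auto simp: M_def)
      also have "\<dots> = real (card M)" by (simp add: M_def)
      finally have "M \<in> hypersimplex_vertices n k"
        using x by (auto simp: hypersimplex_vertices_def M_def)
      moreover have "x = indicator_vec M"
        by (rule poly_mapping_eqI) (use x fin in \<open>auto simp: lookup_indicator_vec M_def in_keys_iff\<close>)
      ultimately show "x \<in> ?T" by blast
    qed
    show "?T \<subseteq> ?S"
    proof
      fix x assume "x \<in> ?T"
      then obtain S where S: "x = indicator_vec S" "S \<subseteq> {..<n}" "card S = k" "finite S"
        by (auto simp: hypersimplex_vertices_def intro: finite_subset)
      have "(\<Sum>i<n. Poly_Mapping.lookup x i) = (\<Sum>i\<in>S. Poly_Mapping.lookup x i)"
        using S by (intro sum.mono_neutral_right) (auto simp: lookup_indicator_vec)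
      also have "\<dots> = real k" using S by (simp add: lookup_indicator_vec)
      finally show "x \<in> ?S"
        using S by (auto simp: lookup_indicator_vec in_keys_iff split: if_splits)
    qed
  qed
  then show ?thesis by (simp only: hypersimplex_def)
qed

lemma hypersimplex_two:
  "hypersimplex n 2 = convex hull (weighted_pair (\<lambda>_ _. 1) ` distinct_pairs n)"
proof -
  have "hypersimplex_vertices n 2 = (\<lambda>(i, j). {i, j}) ` distinct_pairs n"
    by (auto simp: hypersimplex_vertices_def distinct_pairs_def card_2_iff image_def)
  moreover have "indicator_vec {i, j} = weighted_pair (\<lambda>_ _. 1) (i, j)" if "i \<noteq> j" for i j
    using that by (simp add: indicator_vec_def weighted_pair_def)
  ultimately show ?thesis
    unfolding hypersimplex_eq_hull by (auto simp: image_image distinct_pairs_def intro!: arg_cong[where f = "(hull) convex"] image_cong)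
qed

text \<open>The right-hand side does not mention \<alpha>: the incidences agree for all positive
  weights, as \<open>face_lattices_isomorphic_of_incidence\<close> requires.\<close>

lemma pair_constraint_tight:
  assumes "\<And>i j. 0 < \<alpha> i j" "q \<in> distinct_pairs n"
  shows "pair_constraint \<alpha> n (b, k) (weighted_pair \<alpha> q) = 0 \<longleftrightarrow>
    (k = fst q \<or> k = snd q \<longleftrightarrow> \<not> b)"
proof -
  obtain i j where q: "q = (i, j)" "i < n" "j < n" "i \<noteq> j"
    using assms(2) by (auto simp: distinct_pairs_def)
  have nz: "\<alpha> i j \<noteq> 0" for i j using assms(1)[of i j] by simp
  have "0 < \<alpha> k i / \<alpha> i k * \<alpha> i j + \<alpha> k j / \<alpha> j k * \<alpha> j i"
    using assms(1) by (simp add: add_pos_pos)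
  then show ?thesis
    using q nz by (auto simp: pair_constraint_def lookup_weighted_pair slack_weighted_pair)
qed

lemma combinatorial_hypersimplex_weighted_pairs:
  fixes \<alpha> :: "nat \<Rightarrow> nat \<Rightarrow> real"
  assumes "\<And>i j. 0 < \<alpha> i j" "\<And>i j. i < n \<Longrightarrow> j < n \<Longrightarrow> i \<noteq> j \<Longrightarrow> \<alpha> i j + \<alpha> j i = 2"
  shows "combinatorial_hypersimplex n 2 (convex hull (weighted_pair \<alpha> ` distinct_pairs n))"
proof -
  interpret described_polytope "distinct_pairs n" "UNIV \<times> {..<n}" "weighted_pair \<alpha>"
    "pair_constraint \<alpha> n" "{x. Poly_Mapping.keys x \<subseteq> {..<n} \<and> (\<Sum>i<n. Poly_Mapping.lookup x i) = 2}"
    using assms by (rule described_weighted_pairs)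
  show ?thesis
    unfolding combinatorial_hypersimplex_def hypersimplex_two
  proof
    show "polytope P" using fin(1) by (auto simp: polytope_def)
    show "face_lattices_isomorphic P (convex hull (weighted_pair (\<lambda>_ _. 1) ` distinct_pairs n))"
    proof (rule face_lattices_isomorphic_of_incidence)
      show "described_polytope (distinct_pairs n) (UNIV \<times> {..<n}) (weighted_pair (\<lambda>_ _. 1))
        (pair_constraint (\<lambda>_ _. 1) n)
        {x. Poly_Mapping.keys x \<subseteq> {..<n} \<and> (\<Sum>i<n. Poly_Mapping.lookup x i) = 2}"
        by (rule described_weighted_pairs) auto
      show "pair_constraint \<alpha> n j (weighted_pair \<alpha> i) = 0 \<longleftrightarrow>
        pair_constraint (\<lambda>_ _. 1) n j (weighted_pair (\<lambda>_ _. 1) i) = 0"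
        if "i \<in> distinct_pairs n" for i j
        using that assms(1) by (cases j) (simp add: pair_constraint_tight)
    qed (rule described_polytope_axioms)
  qed
qed

section \<open>Faces of polytopes in real vector spaces\<close>

text \<open>The complement of a face in a convex set is convex, so if it contained all of
  \<open>V\<close> it would be the whole hull.\<close>

lemma face_of_convex_hull_meets:
  assumes "F face_of convex hull V" "F \<noteq> {}"
  shows "F \<inter> V \<noteq> {}"
proof
  assume "F \<inter> V = {}"
  moreover have "convex (convex hull V - F)"
  proof (rule convex_alt[THEN iffD2], intro ballI allI impI)
    fix a b and u :: real
    assume a: "a \<in> convex hull V - F" and b: "b \<in> convex hull V - F" and u: "0 \<le> u \<and> u \<le> 1"
    note ab = a b
    let ?x = "(1 - u) *\<^sub>R a + u *\<^sub>R b"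
    have "?x \<in> convex hull V"
      using ab u by (intro convexD_alt) auto
    moreover have "?x \<notin> F"
    proof
      assume x: "?x \<in> F"
      have "a \<noteq> b" "u \<noteq> 0" "u \<noteq> 1"
        using x ab by (auto simp flip: scaleR_left.add)
      then have "?x \<in> open_segment a b"
        using u by (auto simp: in_segment intro!: exI[of _ u])
      then show False using face_ofD[OF assms(1)] x ab by blast
    qed
    ultimately show "?x \<in> convex hull V - F" by blast
  qed
  ultimately have "convex hull V \<subseteq> convex hull V - F"
    by (intro hull_minimal) (auto simp: hull_inc)
  then show False using assms face_of_imp_subset by blast
qed

text \<open>Positive multiples of differences of a convex set already form a subspace: sums are
  merged by weighted averages, and a negative factor swaps the two points.\<close>

lemma span_differences_convex:
  assumes S: "convex S" "S \<noteq> {}" and z: "z \<in> span {x - y |x y. x \<in> S \<and> y \<in> S}"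
  obtains t x y where "0 < t" "x \<in> S" "y \<in> S" "z = t *\<^sub>R (x - y)"
proof -
  define U where "U = {t *\<^sub>R (x - y) |t x y. 0 < t \<and> x \<in> S \<and> y \<in> S}"
  have "subspace U"
  proof (rule subspaceI)
    obtain a where "a \<in> S" using S by auto
    then have "1 *\<^sub>R (a - a) \<in> U" unfolding U_def by (metis (mono_tags, lifting) mem_Collect_eq zero_less_one)
    then show "0 \<in> U" by simp
  next
    fix v w assume "v \<in> U" "w \<in> U"
    then obtain t x y s p q where e: "v = t *\<^sub>R (x - y)" "w = s *\<^sub>R (p - q)" "0 < t" "0 < s"
      "x \<in> S" "y \<in> S" "p \<in> S" "q \<in> S" unfolding U_def by blast
    define a where "a = (t / (t + s)) *\<^sub>R x + (s / (t + s)) *\<^sub>R p"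
    define b where "b = (t / (t + s)) *\<^sub>R y + (s / (t + s)) *\<^sub>R q"
    have "a \<in> S" "b \<in> S"
      unfolding a_def b_def using e by (auto intro!: convexD[OF S(1)] simp flip: add_divide_distrib)
    moreover have "v + w = (t + s) *\<^sub>R (a - b)"
      using e(3,4) by (simp add: e(1,2) a_def b_def scaleR_add_right scaleR_diff_right)
    moreover have "0 < t + s" using e by simp
    ultimately show "v + w \<in> U" unfolding U_def by blast
  next
    fix c :: real and v assume "v \<in> U"
    then obtain t x y where e: "v = t *\<^sub>R (x - y)" "0 < t" "x \<in> S" "y \<in> S" unfolding U_def by blast
    consider "c > 0" | "c = 0" | "c < 0" by linarith
    then show "c *\<^sub>R v \<in> U"
    proof cases
      case 1
      then have "c *\<^sub>R v = (c * t) *\<^sub>R (x - y)" "0 < c * t" using e by auto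
      then show ?thesis unfolding U_def using e by blast
    next
      case 2
      then have "c *\<^sub>R v = 1 *\<^sub>R (x - x)" by simp
      then show ?thesis unfolding U_def using e zero_less_one by blast
    next
      case 3
      then have "c *\<^sub>R v = (- c * t) *\<^sub>R (y - x)" "0 < - c * t"
        using e by (auto simp: scaleR_diff_right mult_neg_pos)
      then show ?thesis unfolding U_def using e by blast
    qed
  qed
  moreover have "{x - y |x y. x \<in> S \<and> y \<in> S} \<subseteq> U"
  proof clarify
    fix x y assume "x \<in> S" "y \<in> S"
    then have "1 *\<^sub>R (x - y) \<in> U" unfolding U_def using zero_less_one by blast
    then show "x - y \<in> U" by simp
  qed
  ultimately have "z \<in> U" using span_minimal z by blast
  then show ?thesis using that unfolding U_def by blast
qed

text \<open>The inverse must again come from a linear map on the whole space. Each vector in the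
  span of the differences of \<open>S\<close> is a scaled difference, so \<open>f\<close> is
  injective on that span and has a globally linear left inverse there.\<close>

lemma affinely_isomorphic_sym:
  assumes "affinely_isomorphic S T" "convex S"
  shows "affinely_isomorphic T S"
proof (cases "S = {}")
  case True
  then have "T = {}" using assms(1) by (auto simp: affinely_isomorphic_def bij_betw_def)
  then show ?thesis using True unfolding affinely_isomorphic_def
    by (intro exI[of _ "\<lambda>x. 0"] exI[of _ 0]) (auto simp: linear_zero bij_betw_def)
next
  case False
  then obtain a where a: "a \<in> S" by auto
  obtain f c where f: "linear f" and bij: "bij_betw (\<lambda>x. f x + c) S T"
    using assms(1) by (auto simp: affinely_isomorphic_def)
  let ?W = "span {x - y |x y. x \<in> S \<and> y \<in> S}"
  have "v = 0" if v: "v \<in> ?W" "f v = 0" for v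
  proof -
    obtain t x y where e: "0 < t" "x \<in> S" "y \<in> S" "v = t *\<^sub>R (x - y)"
      by (rule span_differences_convex[OF assms(2) False v(1)])
    then have "f x + c = f y + c"
      using v(2) by (simp add: linear_cmul[OF f] linear_diff[OF f])
    then have "x = y" using bij e by (auto simp: bij_betw_def inj_on_def)
    then show ?thesis using e by simp
  qed
  then have "inj_on f ?W"
    by (subst linear_inj_on_iff_eq_0[OF f]) (auto simp: subspace_span)
  then obtain g where g: "linear g" "\<And>v. v \<in> ?W \<Longrightarrow> g (f v) = v"
    using linear_exists_left_inverse_on[OF f subspace_span] by blast
  have inv: "g (f x + c) + (a - g (f a + c)) = x" if "x \<in> S" for x
  proof -
    have "x - a \<in> ?W" using that a by (intro span_base) auto
    then have "g (f x) - g (f a) = x - a"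
      using g(2)[of "x - a"] by (simp add: linear_diff[OF f] linear_diff[OF g(1)])
    then show ?thesis by (simp add: linear_add[OF g(1)] algebra_simps)
  qed
  have "bij_betw (\<lambda>y. g y + (a - g (f a + c))) T S"
    by (rule bij_betw_byWitness[where f' = "\<lambda>x. f x + c"])
       (use bij inv in \<open>auto simp: bij_betw_def\<close>)
  then show ?thesis using g(1) unfolding affinely_isomorphic_def by blast
qed

lemma affine_image_comb:
  assumes "linear f" "u + v = 1"
  shows "f (u *\<^sub>R x + v *\<^sub>R y) + c = u *\<^sub>R (f x + c) + v *\<^sub>R (f y + c)"
proof -
  have "c = u *\<^sub>R c + v *\<^sub>R c" using assms(2) by (simp flip: scaleR_add_left)
  then show ?thesis
    by (simp add: linear_add[OF assms(1)] linear_cmul[OF assms(1)] scaleR_add_right)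
qed

lemma affine_image_convex_hull:
  assumes "linear f"
  shows "(\<lambda>x. f x + c) ` (convex hull V) = convex hull ((\<lambda>x. f x + c) ` V)"
proof -
  have "(\<lambda>x. f x + c) = (\<lambda>x. c + x) \<circ> f" by (auto simp: add.commute)
  then show ?thesis
    by (simp only: image_comp[symmetric] convex_hull_linear_image[OF assms] convex_hull_translation)
qed

lemma face_of_affine_image:
  assumes f: "linear f" and inj: "inj_on (\<lambda>x. f x + c) S" and S: "convex S" and F: "F face_of S"
  shows "(\<lambda>x. f x + c) ` F face_of (\<lambda>x. f x + c) ` S"
  unfolding face_of_def
proof (intro conjI ballI impI)
  have FS: "F \<subseteq> S" using F by (rule face_of_imp_subset)
  then show "(\<lambda>x. f x + c) ` F \<subseteq> (\<lambda>x. f x + c) ` S" by blast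
  have "convex F" using F by (rule face_of_imp_convex)
  then show "convex ((\<lambda>x. f x + c) ` F)"
    using affine_image_convex_hull[OF f, of c F] by (metis convex_convex_hull hull_same)
  fix a b x
  assume ab: "a \<in> (\<lambda>x. f x + c) ` S" "b \<in> (\<lambda>x. f x + c) ` S" and x: "x \<in> (\<lambda>x. f x + c) ` F"
    and seg: "x \<in> open_segment a b"
  obtain p q r where e: "a = f p + c" "p \<in> S" "b = f q + c" "q \<in> S" "x = f r + c" "r \<in> F"
    using ab x by blast
  obtain u where u: "0 < u" "u < 1" "x = (1 - u) *\<^sub>R a + u *\<^sub>R b" "a \<noteq> b"
    using seg by (auto simp: in_segment)
  let ?s = "(1 - u) *\<^sub>R p + u *\<^sub>R q"
  have "f ?s + c = f r + c"
    using u e affine_image_comb[OF f, of "1 - u" u p q c] by simp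
  moreover have "?s \<in> S" using e u S by (intro convexD_alt) auto
  ultimately have "r = ?s" using inj e FS by (auto simp: inj_on_def)
  moreover have "p \<noteq> q" using u e by auto
  ultimately have "r \<in> open_segment p q" using u by (auto simp: in_segment)
  then have "p \<in> F" "q \<in> F" using face_ofD[OF F] e by blast+
  then show "a \<in> (\<lambda>x. f x + c) ` F" "b \<in> (\<lambda>x. f x + c) ` F" using e by auto
qed

lemma face_of_linear_vimage:
  assumes f: "linear f" and inj: "inj_on f S" and S: "convex S" and G: "G face_of f ` S"
  shows "{x \<in> S. f x \<in> G} face_of S"
  unfolding face_of_def
proof (intro conjI ballI impI)
  show "convex {x \<in> S. f x \<in> G}"
    using S face_of_imp_convex[OF G]
    by (auto simp: convex_def linear_add[OF f] linear_cmul[OF f])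
  fix a b x
  assume ab: "a \<in> S" "b \<in> S" and x: "x \<in> {x \<in> S. f x \<in> G}" and seg: "x \<in> open_segment a b"
  obtain u where u: "0 < u" "u < 1" "x = (1 - u) *\<^sub>R a + u *\<^sub>R b" "a \<noteq> b"
    using seg by (auto simp: in_segment)
  have "f a \<noteq> f b" using u ab inj by (auto simp: inj_on_def)
  moreover have "f x = (1 - u) *\<^sub>R f a + u *\<^sub>R f b"
    using u by (simp add: linear_add[OF f] linear_cmul[OF f])
  ultimately have "f x \<in> open_segment (f a) (f b)" using u by (auto simp: in_segment)
  then have "f a \<in> G" "f b \<in> G" using face_ofD[OF G] ab x by blast+
  then show "a \<in> {x \<in> S. f x \<in> G}" "b \<in> {x \<in> S. f x \<in> G}" using ab by auto
qed auto

text \<open>Moves a polytope into a Euclidean space, where compactness and exposed faces are at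
  hand: a basis of its difference directions is sent to distinct coordinate vectors.\<close>

lemma ex_linear_inj_on_differences:
  fixes P :: "'a::real_vector set"
  assumes P: "polytope P" and dim: "dim {x - y |x y. x \<in> P \<and> y \<in> P} \<le> DIM('b::euclidean_space)"
  obtains L :: "'a \<Rightarrow> 'b::euclidean_space" where "linear L" "inj_on L P"
proof -
  let ?D = "{x - y |x y. x \<in> P \<and> y \<in> P}"
  obtain V where V: "finite V" "P = convex hull V" using P by (auto simp: polytope_def)
  obtain B where B: "B \<subseteq> ?D" "independent B" "?D \<subseteq> span B" "card B = dim ?D"
    by (rule basis_exists)
  have "P \<subseteq> span V" unfolding V by (simp add: convex_hull_subset_span)
  then have "B \<subseteq> span V" using B(1) by (auto intro!: span_diff)
  then have "finite B" using independent_span_bound[OF V(1) B(2)] by blast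
  then obtain g :: "'a \<Rightarrow> 'b" where g: "g ` B \<subseteq> Basis" "inj_on g B"
    using card_le_inj[OF _ finite_Basis] B(4) dim by metis
  obtain L where L: "linear L" "\<forall>x\<in>B. L x = g x"
    using linear_independent_extend[OF B(2)] by blast
  have "L ` B = g ` B" using L by (auto simp: image_def)
  then have "independent (L ` B)" using g(1) independent_Basis independent_mono by metis
  moreover have "inj_on L B" using g(2) L(2) by (auto simp: inj_on_def)
  ultimately have inj: "inj_on L (span B)"
    by (rule linear_inj_on_span_independent_image[OF L(1)])
  have "inj_on L P"
  proof (rule inj_onI)
    fix x y assume xy: "x \<in> P" "y \<in> P" "L x = L y"
    then have "x - y \<in> span B" using B(3) by blast
    moreover have "L (x - y) = L 0" using xy by (simp add: linear_diff[OF L(1)] linear_0[OF L(1)])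
    ultimately show "x = y" using inj span_zero[of B] by (auto dest: inj_onD)
  qed
  then show ?thesis using that L(1) by blast
qed

text \<open>In the Euclidean image the face is compact and convex, so it has an extreme point, which
  pulls back to a singleton face.\<close>

lemma polytope_face_extreme_point:
  fixes P :: "'a::real_vector set"
  assumes P: "polytope P" and dim: "dim {x - y |x y. x \<in> P \<and> y \<in> P} \<le> DIM('b::euclidean_space)"
    and F: "F face_of P" "F \<noteq> {}"
  obtains x where "x \<in> F" "{x} face_of P"
proof -
  obtain L :: "'a \<Rightarrow> 'b" where L: "linear L" "inj_on L P"
    by (rule ex_linear_inj_on_differences[OF P dim])
  have conv: "convex P" using P by (rule polytope_imp_convex)
  obtain V where V: "finite V" "P = convex hull V" using P by (auto simp: polytope_def)
  have "polytope (L ` P)"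
    unfolding V(2) convex_hull_linear_image[OF L(1)] using V(1) by (auto simp: polytope_def)
  moreover have LF: "L ` F face_of L ` P"
    using face_of_affine_image[OF L(1), of 0] L conv F by simp
  ultimately have "compact (L ` F)" "convex (L ` F)"
    using face_of_polytope_polytope polytope_imp_compact polytope_imp_convex by metis+
  then obtain q where q: "q extreme_point_of L ` F"
    using extreme_point_exists_convex F(2) by blast
  then obtain x where x: "x \<in> F" "q = L x" by (auto simp: extreme_point_of_def)
  have xP: "x \<in> P" using x F face_of_imp_subset by blast
  have "{q} face_of L ` P" using q LF by (meson face_of_singleton extreme_point_of_face)
  then have "{y \<in> P. L y \<in> {q}} face_of P"
    using L conv by (intro face_of_linear_vimage)
  moreover have "{y \<in> P. L y \<in> {q}} = {x}" using L(2) x xP by (auto dest: inj_onD)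
  ultimately show ?thesis using that x by metis
qed

text \<open>Faces of the Euclidean image are exposed; the supporting hyperplane composed with the
  injection gives \<phi>.\<close>

lemma polytope_face_supporting_fun:
  fixes P :: "'a::real_vector set"
  assumes P: "polytope P" and dim: "dim {x - y |x y. x \<in> P \<and> y \<in> P} \<le> DIM('b::euclidean_space)"
    and F: "F face_of P"
  obtains \<phi> where "affine_fun \<phi>" "\<And>x. x \<in> P \<Longrightarrow> 0 \<le> \<phi> x" "F = {x \<in> P. \<phi> x = 0}"
proof -
  obtain L :: "'a \<Rightarrow> 'b" where L: "linear L" "inj_on L P"
    by (rule ex_linear_inj_on_differences[OF P dim])
  have conv: "convex P" using P by (rule polytope_imp_convex)
  have FP: "F \<subseteq> P" using F by (rule face_of_imp_subset)
  obtain V where V: "finite V" "P = convex hull V" using P by (auto simp: polytope_def)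
  have "polytope (L ` P)"
    unfolding V(2) convex_hull_linear_image[OF L(1)] using V(1) by (auto simp: polytope_def)
  moreover have "L ` F face_of L ` P"
    using face_of_affine_image[OF L(1), of 0] L conv F by simp
  ultimately have "L ` F exposed_face_of L ` P"
    using exposed_face_of_polyhedron polytope_imp_polyhedron by blast
  then obtain a b where ab: "L ` P \<subseteq> {x. a \<bullet> x \<le> b}" "L ` F = L ` P \<inter> {x. a \<bullet> x = b}"
    unfolding exposed_face_of_def by blast
  show ?thesis
  proof (rule that[of "\<lambda>x. - (a \<bullet> L x) + b"])
    have "linear (\<lambda>x. - (a \<bullet> L x))"
      by (rule linearI) (simp_all add: linear_add[OF L(1)] linear_cmul[OF L(1)] inner_add_right)
    then show "affine_fun (\<lambda>x. - (a \<bullet> L x) + b)" unfolding affine_fun_def by blast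
    show "0 \<le> - (a \<bullet> L x) + b" if "x \<in> P" for x using that ab by auto
    have "x \<in> F \<longleftrightarrow> a \<bullet> L x = b" if "x \<in> P" for x
    proof -
      have "x \<in> F \<longleftrightarrow> L x \<in> L ` F"
        using L(2) that FP by (metis (no_types, opaque_lifting) inj_on_image_mem_iff)
      then show ?thesis using ab(2) that by blast
    qed
    then show "F = {x \<in> P. - (a \<bullet> L x) + b = 0}" using FP by auto
  qed
qed

text \<open>A point off the facet contributes a direction outside the direction space of
  \<open>F\<close>. As the facet has just one dimension less than \<open>P\<close>, no further
  direction is missing.\<close>

lemma facet_affine_hull:
  fixes P :: "'a::real_vector set"
  assumes P: "polytope P" and F: "is_facet F P" and v: "v \<in> P" "v \<notin> F"
  shows "P \<subseteq> affine hull (insert v F)"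
proof
  let ?D = "\<lambda>S. {x - y |x y. x \<in> S \<and> y \<in> S}"
  have Ff: "F face_of P" "F \<noteq> {}" and "affine_dim F = affine_dim P - 1"
    using F by (auto simp: is_facet_def)
  moreover have "P \<noteq> {}" using v by auto
  ultimately have dim: "dim (?D P) = dim (?D F) + 1" by (simp add: affine_dim_def)
  have conv: "convex F" using Ff by (auto intro: face_of_imp_convex)
  have FP: "F \<subseteq> P" using Ff by (auto dest: face_of_imp_subset)
  obtain a where a: "a \<in> F" using Ff by auto
  obtain V where V: "finite V" "P = convex hull V" using P by (auto simp: polytope_def)
  have "P \<subseteq> span V" unfolding V by (simp add: convex_hull_subset_span)
  then have DV: "?D P \<subseteq> span V" by (blast intro: span_diff)
  have nspan: "v - a \<notin> span (?D F)"
  proof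
    assume mem: "v - a \<in> span (?D F)"
    obtain t x y where e: "0 < t" "x \<in> F" "y \<in> F" "v - a = t *\<^sub>R (x - y)"
      by (rule span_differences_convex[OF conv Ff(2) mem])
    \<comment> \<open>From \<open>v - a = t (x - y)\<close> the vectors \<open>v + t y\<close> and
      \<open>a + t x\<close> coincide. Scaled by \<open>1 / (1 + t)\<close> they give a point of
      \<open>F\<close> strictly between \<open>v\<close> and \<open>y\<close>, so the face property
      would put \<open>v\<close> into \<open>F\<close>.\<close>
    define w where "w = (1 - t / (1 + t)) *\<^sub>R v + (t / (1 + t)) *\<^sub>R y"
    have t: "1 - t / (1 + t) = 1 / (1 + t)" using e(1) by (simp add: field_simps)
    have "w = (1 / (1 + t)) *\<^sub>R (v + t *\<^sub>R y)"
      unfolding w_def t by (simp add: scaleR_add_right)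
    also have "v + t *\<^sub>R y = a + t *\<^sub>R x" using e(4) by (simp add: algebra_simps)
    finally have "w = (1 / (1 + t)) *\<^sub>R a + (t / (1 + t)) *\<^sub>R x"
      by (simp add: scaleR_add_right)
    then have "w \<in> F" using e a by (auto intro!: convexD[OF conv] simp flip: add_divide_distrib)
    moreover have "w \<in> open_segment v y"
        unfolding in_segment w_def using e(1,3) v(2) by (intro conjI exI[of _ "t / (1 + t)"]) auto
    ultimately show False using face_ofD[OF Ff(1)] v e FP by blast
  qed
  obtain B where B: "B \<subseteq> ?D F" "independent B" "?D F \<subseteq> span B" "card B = dim (?D F)"
    by (rule basis_exists)
  have "span B \<subseteq> span (?D F)" using B(1) by (rule span_mono)
  then have "v - a \<notin> span B" using nspan by blast
  then have indep: "independent (insert (v - a) B)" "v - a \<notin> B"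
    using independent_insertI[OF _ B(2)] span_base by blast+
  have BD: "insert (v - a) B \<subseteq> ?D P" using B(1) v a FP by blast
  have finB: "finite B" using independent_span_bound[OF V(1) B(2)] B(1) FP DV by blast
  obtain C where C: "C \<subseteq> ?D P" "independent C" "?D P \<subseteq> span C" "card C = dim (?D P)"
    by (rule basis_exists)
  have finC: "finite C" using independent_span_bound[OF V(1) C(2)] C(1) DV by blast
  \<comment> \<open>By counting: otherwise \<open>dim (?D F) + 2\<close> independent vectors would
    lie in a space of dimension \<open>dim (?D F) + 1\<close>.\<close>
  have spans: "?D P \<subseteq> span (insert (v - a) B)"
  proof (rule ccontr)
    assume "\<not> ?thesis"
    then obtain w where w: "w \<in> ?D P" "w \<notin> span (insert (v - a) B)" by blast
    have "independent (insert w (insert (v - a) B))" by (rule independent_insertI[OF w(2) indep(1)])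
    moreover have "insert w (insert (v - a) B) \<subseteq> span C" using w BD C(3) by blast
    ultimately have "card (insert w (insert (v - a) B)) \<le> card C"
      using independent_span_bound[OF finC] by blast
    moreover have "card (insert w (insert (v - a) B)) = card B + 2"
    proof -
      have "w \<notin> insert (v - a) B" using w(2) span_base by blast
      then show ?thesis using indep(2) finB by simp
    qed
    ultimately show False using B(4) C(4) dim by simp
  qed
  fix X assume X: "X \<in> P"
  have "X - a \<in> span (insert (v - a) B)" using X a FP spans by blast
  then obtain k where k: "X - a - k *\<^sub>R (v - a) \<in> span B" by (auto simp: span_insert)
  have mem: "X - a - k *\<^sub>R (v - a) \<in> span (?D F)" using k \<open>span B \<subseteq> span (?D F)\<close> by blast
  obtain t x y where e: "0 < t" "x \<in> F" "y \<in> F" "X - a - k *\<^sub>R (v - a) = t *\<^sub>R (x - y)"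
    by (rule span_differences_convex[OF conv Ff(2) mem])
  let ?A = "affine hull (insert v F)"
  have in1: "a + t *\<^sub>R (x - y) \<in> ?A"
    using a e by (intro mem_affine_3_minus affine_affine_hull hull_inc) auto
  have "(a + t *\<^sub>R (x - y)) + k *\<^sub>R (v - a) \<in> ?A"
    using a by (intro mem_affine_3_minus[OF affine_affine_hull in1]) (auto intro: hull_inc)
  moreover have "X = (a + t *\<^sub>R (x - y)) + k *\<^sub>R (v - a)"
    using e(4) by (simp add: algebra_simps)
  ultimately show "X \<in> ?A" by simp
qed

section \<open>The vertices and facets of a combinatorial hypersimplex\<close>

lemma hypersimplex_lookup:
  assumes "x \<in> hypersimplex n k"
  shows "0 \<le> Poly_Mapping.lookup x i" "Poly_Mapping.lookup x i \<le> 1"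
    "i \<ge> n \<Longrightarrow> Poly_Mapping.lookup x i = 0"
proof -
  let ?C = "{x::rvec. 0 \<le> Poly_Mapping.lookup x i \<and> Poly_Mapping.lookup x i \<le> 1 \<and>
    (i \<ge> n \<longrightarrow> Poly_Mapping.lookup x i = 0)}"
  have "hypersimplex n k \<subseteq> ?C"
    unfolding hypersimplex_eq_hull
  proof (rule hull_minimal)
    show "indicator_vec ` hypersimplex_vertices n k \<subseteq> ?C"
      using hypersimplex_vertices_finite
      by (auto simp: lookup_indicator_vec) (auto simp: hypersimplex_vertices_def)
    show "convex ?C"
      by (auto simp: convex_def lookup_add lookup_scaleR intro: convex_bound_le)
  qed
  then show "0 \<le> Poly_Mapping.lookup x i" "Poly_Mapping.lookup x i \<le> 1"
    "i \<ge> n \<Longrightarrow> Poly_Mapping.lookup x i = 0" using assms by auto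
qed

lemma convex_hypersimplex: "convex (hypersimplex n k)"
  by (simp add: hypersimplex_eq_hull)

lemma indicator_vec_in: "S \<in> hypersimplex_vertices n k \<Longrightarrow> indicator_vec S \<in> hypersimplex n k"
  by (simp add: hypersimplex_eq_hull hull_inc)

lemma affine_fun_lookup: "affine_fun (\<lambda>x::rvec. Poly_Mapping.lookup x i)"
  unfolding affine_fun_def using linear_lookup[of i]
  by (intro exI[of _ "\<lambda>x. Poly_Mapping.lookup x i"] exI[of _ 0]) simp

lemma affine_fun_one_minus_lookup: "affine_fun (\<lambda>x::rvec. 1 - Poly_Mapping.lookup x i)"
  by (intro affine_fun_diff affine_fun_const affine_fun_lookup)

lemma hypersimplex_face_zero: "{x \<in> hypersimplex n k. Poly_Mapping.lookup x i = 0} face_of hypersimplex n k"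
  by (rule face_of_affine_fun_zero[OF convex_hypersimplex affine_fun_lookup]) (rule hypersimplex_lookup)

lemma hypersimplex_face_one: "{x \<in> hypersimplex n k. 1 - Poly_Mapping.lookup x i = 0} face_of hypersimplex n k"
  by (rule face_of_affine_fun_zero[OF convex_hypersimplex affine_fun_one_minus_lookup])
     (simp add: hypersimplex_lookup)

text \<open>\<phi> adds up the deviations of all coordinates from those of the indicator vector,
  each nonnegative on the hypersimplex.\<close>

lemma hypersimplex_vertex_face:
  assumes S: "S \<in> hypersimplex_vertices n k"
  shows "{indicator_vec S} face_of hypersimplex n k"
proof -
  let ?H = "hypersimplex n k"
  have fin: "finite S" using S by (rule hypersimplex_vertices_finite)
  define \<phi> :: "rvec \<Rightarrow> real" where "\<phi> x = (\<Sum>i\<in>S. 1 - Poly_Mapping.lookup x i)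
    + (\<Sum>i\<in>{..<n} - S. Poly_Mapping.lookup x i)" for x
  have "affine_fun \<phi>"
    unfolding \<phi>_def
    by (intro affine_fun_add affine_fun_sum_fun affine_fun_one_minus_lookup affine_fun_lookup)
  moreover have "0 \<le> \<phi> x" if "x \<in> ?H" for x
    unfolding \<phi>_def using that by (intro add_nonneg_nonneg sum_nonneg) (simp_all add: hypersimplex_lookup)
  ultimately have "{x \<in> ?H. \<phi> x = 0} face_of ?H"
    by (intro face_of_affine_fun_zero convex_hypersimplex)
  moreover have "{x \<in> ?H. \<phi> x = 0} = {indicator_vec S}"
  proof
    show "{indicator_vec S} \<subseteq> {x \<in> ?H. \<phi> x = 0}"
      using indicator_vec_in[OF S] fin by (simp add: \<phi>_def lookup_indicator_vec)
    show "{x \<in> ?H. \<phi> x = 0} \<subseteq> {indicator_vec S}"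
    proof clarify
      fix x assume x: "x \<in> ?H" "\<phi> x = 0"
      have "0 \<le> (\<Sum>i\<in>S. 1 - Poly_Mapping.lookup x i)"
        "0 \<le> (\<Sum>i\<in>{..<n} - S. Poly_Mapping.lookup x i)"
        using x by (auto intro!: sum_nonneg simp: hypersimplex_lookup)
      then have z: "(\<Sum>i\<in>S. 1 - Poly_Mapping.lookup x i) = 0"
        "(\<Sum>i\<in>{..<n} - S. Poly_Mapping.lookup x i) = 0"
        using x(2) by (auto simp: \<phi>_def)
      have z1: "\<forall>i\<in>S. 1 - Poly_Mapping.lookup x i = 0"
        using z(1) x(1) fin by (subst (asm) sum_nonneg_eq_0_iff) (auto simp: hypersimplex_lookup)
      have z2: "\<forall>i\<in>{..<n} - S. Poly_Mapping.lookup x i = 0"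
        using z(2) x(1) by (subst (asm) sum_nonneg_eq_0_iff) (auto simp: hypersimplex_lookup)
      show "x = indicator_vec S"
      proof (intro poly_mapping_eqI)
        fix i
        show "Poly_Mapping.lookup x i = Poly_Mapping.lookup (indicator_vec S) i"
          using z1 z2 hypersimplex_lookup(3)[OF x(1), of i]
          by (cases "i \<in> S"; cases "i < n") (simp_all add: lookup_indicator_vec[OF fin])
      qed
    qed
  qed
  ultimately show ?thesis by simp
qed

text \<open>Swapping \<open>i\<close> and \<open>j\<close> between \<open>S\<close> and
  \<open>T\<close> keeps the sum of the two indicator vectors. Their midpoint is thus also the
  midpoint of the swapped pair, which the face must then contain.\<close>

lemma hypersimplex_face_exchange:
  assumes G: "G face_of hypersimplex n k"
    and S: "S \<in> hypersimplex_vertices n k" "indicator_vec S \<in> G"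
    and T: "T \<in> hypersimplex_vertices n k" "indicator_vec T \<in> G"
    and ij: "i \<in> S - T" "j \<in> T - S"
  shows "insert j (S - {i}) \<in> hypersimplex_vertices n k" "indicator_vec (insert j (S - {i})) \<in> G"
proof -
  have *: "insert b (A - {a}) \<in> hypersimplex_vertices n k"
    if "A \<in> hypersimplex_vertices n k" "B \<in> hypersimplex_vertices n k" "a \<in> A" "b \<in> B" "b \<notin> A" for A B a b
  proof -
    have fin: "finite A" using that hypersimplex_vertices_finite by blast
    then have "card (insert b (A - {a})) = Suc (card (A - {a}))" using that by simp
    also have "\<dots> = card A" by (rule card_Suc_Diff1[OF fin that(3)])
    finally show ?thesis using that by (auto simp: hypersimplex_vertices_def)
  qed
  define S' T' where "S' = insert j (S - {i})" and "T' = insert i (T - {j})"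
  have S': "S' \<in> hypersimplex_vertices n k" and T': "T' \<in> hypersimplex_vertices n k"
    unfolding S'_def T'_def using * S(1) T(1) ij by blast+
  note fin = S(1)[THEN hypersimplex_vertices_finite] T(1)[THEN hypersimplex_vertices_finite]
    S'[THEN hypersimplex_vertices_finite] T'[THEN hypersimplex_vertices_finite]
  let ?m = "(1/2) *\<^sub>R indicator_vec S + (1/2) *\<^sub>R indicator_vec T"
  have "?m = (1 - 1/2) *\<^sub>R indicator_vec S' + (1/2) *\<^sub>R indicator_vec T'"
    by (rule poly_mapping_eqI)
       (use ij fin in \<open>auto simp: lookup_add lookup_scaleR lookup_indicator_vec S'_def T'_def\<close>)
  moreover have "indicator_vec S' \<noteq> indicator_vec T'"
  proof
    assume "indicator_vec S' = indicator_vec T'"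
    then have "Poly_Mapping.lookup (indicator_vec S') i = Poly_Mapping.lookup (indicator_vec T') i" by simp
    then show False using ij fin by (auto simp: lookup_indicator_vec S'_def T'_def split: if_splits)
  qed
  ultimately have "?m \<in> open_segment (indicator_vec S') (indicator_vec T')"
    unfolding in_segment by (intro conjI exI[of _ "1/2"]) auto
  moreover have "?m \<in> G"
    using S T face_of_imp_convex[OF G] by (intro convexD) auto
  ultimately have "indicator_vec S' \<in> G"
    using face_ofD[OF G] indicator_vec_in S' T' by blast
  then show "insert j (S - {i}) \<in> hypersimplex_vertices n k" "indicator_vec (insert j (S - {i})) \<in> G"
    using S' by (simp_all add: S'_def)
qed

text \<open>Collects what the main argument takes from the face lattice: vertices labelled by
  \<open>k\<close>-subsets, the exchange property of faces, and functions \<open>g i\<close> and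
  \<open>h i\<close> supporting the faces that correspond to \<open>x_i = 1\<close> and
  \<open>x_i = 0\<close>.\<close>

lemma combinatorial_hypersimplex_structure:
  fixes P :: "'a::real_vector set"
  assumes P: "combinatorial_hypersimplex n k P"
    and dim: "dim {x - y |x y. x \<in> P \<and> y \<in> P} \<le> DIM('b::euclidean_space)"
  obtains v :: "nat set \<Rightarrow> 'a" and g h :: "nat \<Rightarrow> 'a \<Rightarrow> real" where
    "\<And>S. S \<in> hypersimplex_vertices n k \<Longrightarrow> {v S} face_of P"
    "inj_on v (hypersimplex_vertices n k)"
    "\<And>x. {x} face_of P \<Longrightarrow> x \<in> v ` hypersimplex_vertices n k"
    "\<And>G S T i j. G face_of P \<Longrightarrow> S \<in> hypersimplex_vertices n k \<Longrightarrow> T \<in> hypersimplex_vertices n k \<Longrightarrow>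
      v S \<in> G \<Longrightarrow> v T \<in> G \<Longrightarrow> i \<in> S - T \<Longrightarrow> j \<in> T - S \<Longrightarrow>
      insert j (S - {i}) \<in> hypersimplex_vertices n k \<and> v (insert j (S - {i})) \<in> G"
    "\<And>i. affine_fun (g i)" "\<And>i x. x \<in> P \<Longrightarrow> 0 \<le> g i x"
    "\<And>i S. S \<in> hypersimplex_vertices n k \<Longrightarrow> g i (v S) = 0 \<longleftrightarrow> i \<in> S"
    "\<And>i. affine_fun (h i)" "\<And>i x. x \<in> P \<Longrightarrow> 0 \<le> h i x"
    "\<And>i S. S \<in> hypersimplex_vertices n k \<Longrightarrow> h i (v S) = 0 \<longleftrightarrow> i \<notin> S"
proof -
  let ?H = "hypersimplex n k" and ?V = "hypersimplex_vertices n k"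
  have poly: "polytope P" using P by (simp add: combinatorial_hypersimplex_def)
  obtain \<phi> where bij: "bij_betw \<phi> {F. F face_of P} {G. G face_of ?H}"
    and ord: "\<And>F F'. F face_of P \<Longrightarrow> F' face_of P \<Longrightarrow> F \<subseteq> F' \<longleftrightarrow> \<phi> F \<subseteq> \<phi> F'"
    using P unfolding combinatorial_hypersimplex_def face_lattices_isomorphic_def by blast
  have im: "\<phi> ` {F. F face_of P} = {G. G face_of ?H}"
    by (rule bij_betw_imp_surj_on[OF bij])
  have \<phi>f: "\<phi> F face_of ?H" if F: "F face_of P" for F
  proof -
    have "\<phi> F \<in> \<phi> ` {F. F face_of P}" using F by (intro imageI) simp
    then show ?thesis unfolding im by simp
  qed
  have surj: "\<exists>F. F face_of P \<and> \<phi> F = G" if G: "G face_of ?H" for G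
  proof -
    have "G \<in> \<phi> ` {F. F face_of P}" unfolding im using G by simp
    then obtain F where "F face_of P" "G = \<phi> F" by (elim imageE) simp
    then show ?thesis by (intro exI[of _ F]) simp
  qed
  have "\<phi> {} = {}"
  proof -
    obtain F where "F face_of P" "\<phi> F = {}" using surj[of "{}"] by auto
    then show ?thesis using ord[of "{}" F] by auto
  qed
  then have ne: "\<phi> F \<noteq> {}" if "F face_of P" "F \<noteq> {}" for F
    using ord[of F "{}"] that by auto
  have eqI: "F = F'" if "F face_of P" "F' face_of P" "\<phi> F = \<phi> F'" for F F'
    using ord that by blast
  \<comment> \<open>The face matched with a vertex contains a singleton face, whose image is
    nonempty and lies inside a singleton; so vertices correspond to vertices.\<close>
  have "\<exists>x. {x} face_of P \<and> \<phi> {x} = {indicator_vec S}" if S: "S \<in> ?V" for S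
  proof -
    obtain K where K: "K face_of P" "\<phi> K = {indicator_vec S}"
      using surj hypersimplex_vertex_face[OF S] by blast
    then have "K \<noteq> {}" using \<open>\<phi> {} = {}\<close> by auto
    then obtain x where x: "x \<in> K" "{x} face_of P"
      using polytope_face_extreme_point[OF poly dim K(1)] by blast
    then have "\<phi> {x} \<subseteq> {indicator_vec S}" using ord[OF x(2) K(1)] K(2) by auto
    then show ?thesis using ne[OF x(2)] x(2) by blast
  qed
  then obtain v where v: "\<And>S. S \<in> ?V \<Longrightarrow> {v S} face_of P"
    "\<And>S. S \<in> ?V \<Longrightarrow> \<phi> {v S} = {indicator_vec S}" by metis
  have mem: "v S \<in> F \<longleftrightarrow> indicator_vec S \<in> \<phi> F" if "S \<in> ?V" "F face_of P" for S F
    using ord[OF v(1)[OF that(1)] that(2)] v(2)[OF that(1)] by auto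
  have ind_inj: "S = T" if "S \<in> ?V" "T \<in> ?V" "indicator_vec S = indicator_vec T" for S T
  proof (rule set_eqI)
    fix i
    show "i \<in> S \<longleftrightarrow> i \<in> T"
      using lookup_indicator_vec[OF hypersimplex_vertices_finite[OF that(1)], of i]
        lookup_indicator_vec[OF hypersimplex_vertices_finite[OF that(2)], of i] that(3)
      by (simp split: if_splits)
  qed
  have vinj: "inj_on v ?V" using v(2) ind_inj by (intro inj_onI) (metis the_elem_eq)
  have vall: "x \<in> v ` ?V" if x: "{x} face_of P" for x
  proof -
    obtain S where S: "S \<in> ?V" "indicator_vec S \<in> \<phi> {x}"
      using face_of_convex_hull_meets[of "\<phi> {x}" "indicator_vec ` ?V"] \<phi>f[OF x] ne[OF x]
      by (auto simp: hypersimplex_eq_hull)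
    then have "v S = x" using mem[OF S(1) x] by simp
    then show ?thesis using S by blast
  qed
  have exch: "insert j (S - {i}) \<in> ?V \<and> v (insert j (S - {i})) \<in> G"
    if "G face_of P" "S \<in> ?V" "T \<in> ?V" "v S \<in> G" "v T \<in> G" "i \<in> S - T" "j \<in> T - S" for G S T i j
  proof -
    have "indicator_vec S \<in> \<phi> G" "indicator_vec T \<in> \<phi> G" using mem that by blast+
    then show ?thesis
      using hypersimplex_face_exchange[OF \<phi>f[OF that(1)] that(2) _ that(3) _ that(6,7)] mem that(1) by blast
  qed
  have supp: "\<exists>f. affine_fun f \<and> (\<forall>x\<in>P. 0 \<le> f x) \<and> (\<forall>S\<in>?V. f (v S) = 0 \<longleftrightarrow> indicator_vec S \<in> G)"
    if G: "G face_of ?H" for G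
  proof -
    obtain F where F: "F face_of P" "\<phi> F = G" using surj[OF G] by blast
    obtain f where f: "affine_fun f" "\<And>x. x \<in> P \<Longrightarrow> 0 \<le> f x" "F = {x \<in> P. f x = 0}"
      by (rule polytope_face_supporting_fun[OF poly dim F(1)]) (rule that)
    have "f (v S) = 0 \<longleftrightarrow> indicator_vec S \<in> G" if S: "S \<in> ?V" for S
    proof -
      have "v S \<in> P" using v(1)[OF S] face_of_imp_subset by blast
      then show ?thesis using mem[OF S F(1)] F(2) f(3) by auto
    qed
    then show ?thesis using f by blast
  qed
  have "\<exists>f. affine_fun f \<and> (\<forall>x\<in>P. 0 \<le> f x) \<and> (\<forall>S\<in>?V. f (v S) = 0 \<longleftrightarrow> i \<in> S)" for i
  proof -
    have "indicator_vec S \<in> {x \<in> ?H. 1 - Poly_Mapping.lookup x i = 0} \<longleftrightarrow> i \<in> S" if "S \<in> ?V" for S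
      using indicator_vec_in[OF that] lookup_indicator_vec[OF hypersimplex_vertices_finite[OF that]] by simp
    then show ?thesis using supp[OF hypersimplex_face_one[of n k i]] by simp
  qed
  then obtain g where g: "\<And>i. affine_fun (g i) \<and> (\<forall>x\<in>P. 0 \<le> g i x) \<and> (\<forall>S\<in>?V. g i (v S) = 0 \<longleftrightarrow> i \<in> S)"
    by metis
  have "\<exists>f. affine_fun f \<and> (\<forall>x\<in>P. 0 \<le> f x) \<and> (\<forall>S\<in>?V. f (v S) = 0 \<longleftrightarrow> i \<notin> S)" for i
  proof -
    have "indicator_vec S \<in> {x \<in> ?H. Poly_Mapping.lookup x i = 0} \<longleftrightarrow> i \<notin> S" if "S \<in> ?V" for S
      using indicator_vec_in[OF that] lookup_indicator_vec[OF hypersimplex_vertices_finite[OF that]] by simp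
    then show ?thesis using supp[OF hypersimplex_face_zero[of n k i]] by simp
  qed
  then obtain h where h: "\<And>i. affine_fun (h i) \<and> (\<forall>x\<in>P. 0 \<le> h i x) \<and> (\<forall>S\<in>?V. h i (v S) = 0 \<longleftrightarrow> i \<notin> S)"
    by metis
  show ?thesis
  proof (rule that[of v g h])
    show "insert j (S - {i}) \<in> ?V \<and> v (insert j (S - {i})) \<in> G"
      if "G face_of P" "S \<in> ?V" "T \<in> ?V" "v S \<in> G" "v T \<in> G" "i \<in> S - T" "j \<in> T - S" for G S T i j
      by (rule exch[OF that])
    show "inj_on v ?V" by (rule vinj)
  qed (use v(1) vall g h in auto)
qed

section \<open>Families of sets pairwise meeting in all but one element\<close>

text \<open>Such families come in two kinds: sets through a common \<open>m\<close>-set, and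
  \<open>Suc m\<close>-subsets of a set of size \<open>m + 2\<close>. The second kind has at most
  \<open>m + 2\<close> members, which the size bound excludes.\<close>

lemma common_core:
  assumes \<F>: "\<And>X. X \<in> \<F> \<Longrightarrow> finite X" "\<And>X. X \<in> \<F> \<Longrightarrow> card X = Suc m"
    "\<And>X Y. X \<in> \<F> \<Longrightarrow> Y \<in> \<F> \<Longrightarrow> X \<noteq> Y \<Longrightarrow> card (X \<inter> Y) = m" and big: "m + 2 < card \<F>"
  shows "\<exists>D. finite D \<and> card D = m \<and> (\<forall>X\<in>\<F>. D \<subseteq> X)"
proof -
  have fin: "finite \<F>" using big by (intro card_ge_0_finite) simp
  have "\<not> card \<F> \<le> Suc 0" using big by simp
  then obtain A B where AB: "A \<in> \<F>" "B \<in> \<F>" "A \<noteq> B"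
    using card_le_Suc0_iff_eq[OF fin] by blast
  have finAB: "finite (A \<union> B)" using \<F>(1) AB by simp
  have cU: "card (A \<union> B) = m + 2"
    using card_Un_Int[of A B] \<F> AB by simp
  show ?thesis
  proof (cases "\<forall>X\<in>\<F>. A \<inter> B \<subseteq> X")
    case True
    then show ?thesis using \<F> AB by (intro exI[of _ "A \<inter> B"]) auto
  next
    case False
    \<comment> \<open>\<open>C\<close> forces the second kind. A member with a point outside
      \<open>A \<union> B\<close> consists of \<open>A \<inter> B\<close> and that point, so
      \<open>C\<close> has no such point, and any other member with one would meet \<open>C\<close>
      in fewer than \<open>m\<close> points.\<close>
    then obtain C where C: "C \<in> \<F>" "\<not> A \<inter> B \<subseteq> C" by auto
    have rest: "X - {w} \<subseteq> A \<inter> B" "card (X - {w}) = m" if X: "X \<in> \<F>" "w \<in> X" "w \<notin> A \<union> B" for X w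
    proof -
      show c: "card (X - {w}) = m" using X \<F> by simp
      have "X \<noteq> A" "X \<noteq> B" using X by auto
      then have "card (X \<inter> A) = m" "card (X \<inter> B) = m" using \<F>(3) X AB by auto
      moreover have "X \<inter> A \<subseteq> X - {w}" "X \<inter> B \<subseteq> X - {w}" using X by auto
      moreover have "finite (X - {w})" using \<F>(1) X by simp
      ultimately have "X \<inter> A = X - {w}" "X \<inter> B = X - {w}"
        using c by (metis card_subset_eq)+
      then show "X - {w} \<subseteq> A \<inter> B" by blast
    qed
    have cAB: "card (A \<inter> B) = m" "finite (A \<inter> B)" using \<F> AB by auto
    have all: "X - {w} = A \<inter> B" if X: "X \<in> \<F>" "w \<in> X" "w \<notin> A \<union> B" for X w
      using rest[OF X] cAB by (metis card_subset_eq)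
    have CU: "C \<subseteq> A \<union> B"
      using all[OF C(1)] C(2) by blast
    have "X \<subseteq> A \<union> B" if X: "X \<in> \<F>" for X
    proof
      fix w assume w: "w \<in> X"
      show "w \<in> A \<union> B"
      proof (rule ccontr)
        assume nw: "w \<notin> A \<union> B"
        have e: "X - {w} = A \<inter> B" using all[OF X w nw] .
        have "X \<noteq> C" using w nw CU by blast
        then have "card (X \<inter> C) = m" using \<F>(3) X C by blast
        moreover have "X \<inter> C \<subset> A \<inter> B" using e nw CU C(2) by blast
        then have "card (X \<inter> C) < card (A \<inter> B)" by (rule psubset_card_mono[OF cAB(2)])
        ultimately show False using cAB by simp
      qed
    qed
    then have "\<F> \<subseteq> {X. X \<subseteq> A \<union> B \<and> card X = Suc m}" using \<F>(2) by auto
    then have "card \<F> \<le> card {X. X \<subseteq> A \<union> B \<and> card X = Suc m}"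
      using finAB by (intro card_mono) auto
    also have "\<dots> = (m + 2) choose Suc m" using n_subsets[OF finAB] cU by simp
    also have "\<dots> = m + 2" by simp
    finally show ?thesis using big by simp
  qed
qed

text \<open>The five sets at an index exceed the bound 4 of \<open>common_core\<close> and share a
  pair \<open>D i\<close>. The six pairs \<open>D i\<close> meet pairwise in one point and exceed
  the bound 3, so they share \<open>z\<close>.\<close>

lemma triangular_labelling:
  fixes s :: "nat \<Rightarrow> nat \<Rightarrow> nat set"
  assumes s: "\<And>i j. i < 6 \<Longrightarrow> j < 6 \<Longrightarrow> i \<noteq> j \<Longrightarrow> s i j \<subseteq> {..<7} \<and> card (s i j) = 3 \<and> s i j = s j i"
    and inj: "\<And>i j k l. i < 6 \<Longrightarrow> j < 6 \<Longrightarrow> k < 6 \<Longrightarrow> l < 6 \<Longrightarrow> i \<noteq> j \<Longrightarrow> k \<noteq> l \<Longrightarrow>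
      s i j = s k l \<Longrightarrow> {i, j} = {k, l}"
    and adj: "\<And>i j k. i < 6 \<Longrightarrow> j < 6 \<Longrightarrow> k < 6 \<Longrightarrow> i \<noteq> j \<Longrightarrow> i \<noteq> k \<Longrightarrow> j \<noteq> k \<Longrightarrow>
      card (s i j \<inter> s i k) = 2"
  obtains z \<pi> where "z < 7" "inj_on \<pi> {..<6}" "\<And>i. i < 6 \<Longrightarrow> \<pi> i < 7 \<and> \<pi> i \<noteq> z"
    "\<And>i j. i < 6 \<Longrightarrow> j < 6 \<Longrightarrow> i \<noteq> j \<Longrightarrow> s i j = {z, \<pi> i, \<pi> j}"
proof -
  have fin: "finite (s i j)" if "i < 6" "j < 6" "i \<noteq> j" for i j
    using s[OF that] finite_subset by blast
  have star: "card (s i ` ({..<6} - {i})) = 5" if "i < 6" for i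
  proof -
    have "inj_on (s i) ({..<6} - {i})"
    proof (rule inj_onI)
      fix j k assume "j \<in> {..<6} - {i}" "k \<in> {..<6} - {i}" "s i j = s i k"
      then have "{i, j} = {i, k}" using inj[of i j i k] that by auto
      then show "j = k" by (metis doubleton_eq_iff)
    qed
    then show ?thesis using that by (simp add: card_image)
  qed
  have "\<exists>D. finite D \<and> card D = 2 \<and> (\<forall>X\<in>s i ` ({..<6} - {i}). D \<subseteq> X)" if i: "i < 6" for i
  proof (rule common_core)
    show "finite X" "card X = Suc 2" if "X \<in> s i ` ({..<6} - {i})" for X
      using that fin s i by auto
    show "card (X \<inter> Y) = 2" if "X \<in> s i ` ({..<6} - {i})" "Y \<in> s i ` ({..<6} - {i})" "X \<noteq> Y" for X Y
      using that adj i by auto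
    show "2 + 2 < card (s i ` ({..<6} - {i}))" using star[OF i] by simp
  qed
  then obtain D where D: "\<And>i. i < 6 \<Longrightarrow> finite (D i) \<and> card (D i) = 2"
    "\<And>i j. i < 6 \<Longrightarrow> j < 6 \<Longrightarrow> i \<noteq> j \<Longrightarrow> D i \<subseteq> s i j"
    by (metis (no_types, lifting) DiffI empty_iff imageI insert_iff lessThan_iff)
  \<comment> \<open>Equal pairs would put six triples through one pair, but only five points of
    \<open>{..<7}\<close> remain to complete it.\<close>
  have Dneq: "D i \<noteq> D j" if ij: "i < 6" "j < 6" "i \<noteq> j" for i j
  proof
    assume eq: "D i = D j"
    obtain l where l: "l < 6" "l \<noteq> i" "l \<noteq> j"
    proof -
      have "card {i, j} < card {..<6::nat}" by (rule le_less_trans[OF card_insert_le_m1[of 2]]) auto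
      then have "\<not> {..<6} \<subseteq> {i, j}" by (meson card_mono finite.intros leD)
      then show ?thesis using that by auto
    qed
    have "s j l \<notin> s i ` ({..<6} - {i})"
    proof
      assume "s j l \<in> s i ` ({..<6} - {i})"
      then obtain k where "k < 6" "k \<noteq> i" "s j l = s i k" by auto
      then have "{j, l} = {i, k}" using inj[of j l i k] ij l by auto
      then show False using ij l by (auto simp: doubleton_eq_iff)
    qed
    then have "card (insert (s j l) (s i ` ({..<6} - {i}))) = 6" using star[OF ij(1)] by simp
    moreover have "insert (s j l) (s i ` ({..<6} - {i})) \<subseteq> (\<lambda>x. insert x (D i)) ` ({..<7} - D i)"
    proof
      fix X assume "X \<in> insert (s j l) (s i ` ({..<6} - {i}))"
      then obtain a b where ab: "X = s a b" "a < 6" "b < 6" "a \<noteq> b" "D a = D i"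
        using ij l eq by auto
      then have X: "D i \<subseteq> X" "X \<subseteq> {..<7}" "card X = 3" "finite X"
        using D(2)[OF ab(2-4)] s[OF ab(2-4)] fin[OF ab(2-4)] by auto
      then have "card (X - D i) = 1" using D(1)[OF ij(1)] by (simp add: card_Diff_subset)
      then obtain x where "X - D i = {x}" by (auto simp: card_1_singleton_iff)
      then have "X = insert x (D i)" "x \<in> {..<7} - D i" using X by auto
      then show "X \<in> (\<lambda>x. insert x (D i)) ` ({..<7} - D i)" by blast
    qed
    then have "card (insert (s j l) (s i ` ({..<6} - {i}))) \<le> card ({..<7} - D i)"
      by (meson card_image_le card_mono finite_Diff finite_imageI finite_lessThan le_trans)
    moreover have "D i \<subseteq> {..<7}" using D(2)[OF ij] s[OF ij] by auto
    then have "card ({..<7} - D i) = 5" using D(1)[OF ij(1)] by (simp add: card_Diff_subset)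
    ultimately show False by simp
  qed
  have union: "s i j = D i \<union> D j" and inter: "card (D i \<inter> D j) = 1" if ij: "i < 6" "j < 6" "i \<noteq> j" for i j
  proof -
    have sub: "D i \<union> D j \<subseteq> s i j" using D(2)[OF ij] D(2)[of j i] ij s[OF ij] by auto
    have "D i \<subset> D i \<union> D j"
      using D(1) Dneq[OF ij] ij by (metis Un_upper1 Un_upper2 card_subset_eq psubsetI)
    then have "2 < card (D i \<union> D j)" using D(1) ij by (metis finite_UnI psubset_card_mono)
    moreover have "card (D i \<union> D j) \<le> 3" using sub s[OF ij] fin[OF ij] by (metis card_mono)
    ultimately have c: "card (D i \<union> D j) = 3" by simp
    then show "s i j = D i \<union> D j" using sub s[OF ij] fin[OF ij] by (metis card_subset_eq)
    show "card (D i \<inter> D j) = 1" using card_Un_Int[of "D i" "D j"] D(1) ij c by simp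
  qed
  have "inj_on D {..<6}" using Dneq by (auto simp: inj_on_def)
  then have "card (D ` {..<6}) = 6" by (simp add: card_image)
  then have "\<exists>Z. finite Z \<and> card Z = 1 \<and> (\<forall>X\<in>D ` {..<6}. Z \<subseteq> X)"
    using D(1) inter by (intro common_core) auto
  then obtain z where z: "\<And>i. i < 6 \<Longrightarrow> z \<in> D i" by (auto simp: card_1_singleton_iff)
  have "\<exists>x. x \<noteq> z \<and> D i = {z, x}" if i: "i < 6" for i
  proof -
    obtain x y where "D i = {x, y}" "x \<noteq> y" using D(1)[OF i] by (auto simp: card_2_iff)
    then show ?thesis using z[OF i] by auto
  qed
  then obtain \<pi> where \<pi>: "\<And>i. i < 6 \<Longrightarrow> \<pi> i \<noteq> z \<and> D i = {z, \<pi> i}" by metis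
  have D7: "D i \<subseteq> {..<7}" if "i < 6" for i
  proof (cases "i = 0")
    case True
    then show ?thesis using D(2)[of 0 1] s[of 0 1] by auto
  next
    case False
    then show ?thesis using D(2)[of i 0] s[of i 0] that by auto
  qed
  show ?thesis
  proof (rule that[of z \<pi>])
    show "z < 7" using z[of 0] D7[of 0] by auto
    show "inj_on \<pi> {..<6}"
    proof (rule inj_onI)
      fix i j assume "i \<in> {..<6}" "j \<in> {..<6}" "\<pi> i = \<pi> j"
      then show "i = j" using Dneq[of i j] \<pi>[of i] \<pi>[of j] by auto
    qed
    show "\<pi> i < 7 \<and> \<pi> i \<noteq> z" if "i < 6" for i using \<pi>[OF that] D7[OF that] by auto
    show "s i j = {z, \<pi> i, \<pi> j}" if "i < 6" "j < 6" "i \<noteq> j" for i j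
      using union[OF that] \<pi>[OF that(1)] \<pi>[OF that(2)] by auto
  qed
qed

section \<open>An infeasible system\<close>

text \<open>Both tilted edges carry the larger weight at index 1. The quotient of their weights is
  3, the source of the coefficients 3 and 1/3 below.\<close>

definition skew_weight :: "nat \<Rightarrow> nat \<Rightarrow> real" where
  "skew_weight i j = (if i = 1 \<and> j \<in> {0, 2} then 3/2 else if j = 1 \<and> i \<in> {0, 2} then 1/2 else 1)"

text \<open>The equations \<open>par\<close> put the vectors \<open>(G k, u k)\<close> on one line
  through the origin. There the symmetric form in \<open>m\<close> becomes
  \<open>2 * r * y k * y l\<close>, and its common nonzero value makes the \<open>y k\<close>
  agree.\<close>

lemma parallel_pairs_equal:
  fixes a b m :: real and G u :: "nat \<Rightarrow> real"
  assumes "a \<noteq> 0 \<or> b \<noteq> 0" "m \<noteq> 0"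
    and par: "a * u 3 + b * G 3 = 0" "a * u 4 + b * G 4 = 0" "a * u 5 + b * G 5 = 0"
    and m: "G 3 * u 4 + G 4 * u 3 = m" "G 3 * u 5 + G 5 * u 3 = m" "G 4 * u 5 + G 5 * u 4 = m"
  shows "G 3 = G 4" "G 3 = G 5" "u 3 = u 4" "u 3 = u 5"
proof -
  have *: "y 3 = y 4 \<and> y 3 = y 5"
    if "\<And>k. k \<in> {3,4,5} \<Longrightarrow> x k = r * y k"
      "x 3 * y 4 + x 4 * y 3 = m" "x 3 * y 5 + x 5 * y 3 = m" "x 4 * y 5 + x 5 * y 4 = m"
    for x y :: "nat \<Rightarrow> real" and r
  proof -
    have "2 * r * y 3 * y 4 = m" "2 * r * y 3 * y 5 = m" "2 * r * y 4 * y 5 = m"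
      using that by (simp_all add: algebra_simps)
    then show ?thesis using \<open>m \<noteq> 0\<close> by auto
  qed
  have "G 3 = G 4 \<and> G 3 = G 5 \<and> u 3 = u 4 \<and> u 3 = u 5"
  proof (cases "a = 0")
    case False
    define r where "r = - b / a"
    have r: "u k = r * G k" if "k \<in> {3,4,5}" for k
      using that par False by (auto simp: r_def field_simps)
    then show ?thesis using *[of u r G] m by (auto simp: mult.commute add.commute)
  next
    case True
    then have "G k = 0 * u k" if "k \<in> {3,4,5}" for k
      using that par assms(1) by auto
    then show ?thesis using m assms(2) by auto
  qed
  then show "G 3 = G 4" "G 3 = G 5" "u 3 = u 4" "u 3 = u 5" by auto
qed

text \<open>The vectors \<open>(G i, u i)\<close> are compared through the symmetric bilinear form
  \<open>M\<close>. Unit-weight triples fix most of its values, triples with one tilted edge then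
  force the vectors at 0, 1 and 2 to agree, and the triple with both tilted edges contradicts
  this.\<close>

lemma weighted_system_infeasible:
  fixes G u :: "nat \<Rightarrow> real" and C :: real
  assumes sys: "\<And>i j k. i < 6 \<Longrightarrow> j < 6 \<Longrightarrow> k < 6 \<Longrightarrow> i \<noteq> j \<Longrightarrow> i \<noteq> k \<Longrightarrow> j \<noteq> k \<Longrightarrow>
      \<exists>x y z. 0 < x \<and> 0 < y \<and> 0 < z \<and>
        skew_weight i j / skew_weight j i * y + skew_weight i k / skew_weight k i * z - x = G i \<and>
        skew_weight j i / skew_weight i j * x + skew_weight j k / skew_weight k j * z - y = G j \<and>
        skew_weight k i / skew_weight i k * x + skew_weight k j / skew_weight j k * y - z = G k \<and>
        u i * x + u j * y + u k * z = C"
    and pos: "\<And>i j. i < 6 \<Longrightarrow> j < 6 \<Longrightarrow> i \<noteq> j \<Longrightarrow> 0 < skew_weight i j * u i + skew_weight j i * u j"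
  shows False
proof -
  define M where "M i j = G i * u j + G j * u i" for i j
  \<comment> \<open>All pairwise sums among \<open>u 0\<close>, \<open>u 3\<close>,
    \<open>u 4\<close>, \<open>u 5\<close> are positive, so at most one of them is nonpositive; the
    other three display \<open>C\<close> as a sum of positive terms.\<close>
  have C: "C > 0"
  proof -
    have "0 < u 3 + u 4" "0 < u 3 + u 5" "0 < u 4 + u 5" "0 < u 0 + u 3" "0 < u 0 + u 4" "0 < u 0 + u 5"
      using pos[of 3 4] pos[of 3 5] pos[of 4 5] pos[of 0 3] pos[of 0 4] pos[of 0 5]
      by (simp_all add: skew_weight_def)
    then consider "0 < u 3" "0 < u 4" "0 < u 5" | "0 < u 0" "0 < u 4" "0 < u 5"
      | "0 < u 0" "0 < u 3" "0 < u 5" | "0 < u 0" "0 < u 3" "0 < u 4"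
      by linarith
    then obtain i j k :: nat where "i < 6" "j < 6" "k < 6" "i \<noteq> j" "i \<noteq> k" "j \<noteq> k"
      "0 < u i" "0 < u j" "0 < u k"
    proof cases
      case 1 then show ?thesis using that[of 3 4 5] by simp
    next
      case 2 then show ?thesis using that[of 0 4 5] by simp
    next
      case 3 then show ?thesis using that[of 0 3 5] by simp
    next
      case 4 then show ?thesis using that[of 0 3 4] by simp
    qed
    moreover from this sys[of i j k] obtain x y z
      where "0 < x" "0 < y" "0 < z" "C = u i * x + u j * y + u k * z" by metis
    ultimately show ?thesis by (simp add: add_pos_pos)
  qed
  \<comment> \<open>With unit weights the first three equations give
    \<open>2 * x = G j + G k\<close> and its analogues, which are inserted into the fourth.\<close>
  have clean: "M i j + M i k + M j k = 2 * C"
    if "i < 6" "j < 6" "k < 6" "i \<noteq> j" "i \<noteq> k" "j \<noteq> k" "skew_weight i j = 1" "skew_weight j i = 1"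
      "skew_weight i k = 1" "skew_weight k i = 1" "skew_weight j k = 1" "skew_weight k j = 1" for i j k
  proof -
    note ijk = that
    obtain x y z where e: "y + z - x = G i" "x + z - y = G j" "x + y - z = G k"
      "u i * x + u j * y + u k * z = C"
      using sys[OF ijk(1-6)] ijk by auto
    have "2 * x = G j + G k" "2 * y = G i + G k" "2 * z = G i + G j"
      using e(1-3) by auto
    moreover have "2 * C = u i * (2 * x) + u j * (2 * y) + u k * (2 * z)"
      using e(4) by (simp add: algebra_simps)
    ultimately show ?thesis by (simp add: M_def algebra_simps)
  qed
  \<comment> \<open>The ten triples in \<open>{0,2,3,4,5}\<close> avoid the tilted edges and
    determine the ten values of \<open>M\<close> on this set.\<close>
  have M: "M 0 2 = 2*C/3" "M 0 3 = 2*C/3" "M 0 4 = 2*C/3" "M 0 5 = 2*C/3" "M 2 3 = 2*C/3"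
    "M 2 4 = 2*C/3" "M 2 5 = 2*C/3" "M 3 4 = 2*C/3" "M 3 5 = 2*C/3" "M 4 5 = 2*C/3"
    using clean[of 0 2 3] clean[of 0 2 4] clean[of 0 2 5] clean[of 0 3 4] clean[of 0 3 5]
      clean[of 0 4 5] clean[of 2 3 4] clean[of 2 3 5] clean[of 2 4 5] clean[of 3 4 5]
    by (simp_all add: skew_weight_def)
  have M1: "M 1 3 = 2*C/3" "M 1 4 = 2*C/3" "M 1 5 = 2*C/3"
    using clean[of 1 3 4] clean[of 1 3 5] clean[of 1 4 5] M by (simp_all add: skew_weight_def)
  \<comment> \<open>The same elimination for a triple with exactly one tilted edge.\<close>
  have skew: "4 * C = u i * (G 1 + G 3) + 3 * (u 1 * (G i + G 3)) + u 3 * (3 * G i + G 1)"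
    if "i \<in> {0, 2}" for i
  proof -
    note i = that
    obtain x y z where e: "y / 3 + z - x = G i" "3 * x + z - y = G 1" "x + y - z = G 3"
      "u i * x + u 1 * y + u 3 * z = C"
      using sys[of i 1 3] i by (auto simp: skew_weight_def)
    have "4 * x = G 1 + G 3" "4 * y = 3 * (G i + G 3)" "4 * z = 3 * G i + G 1"
      using e(1-3) by auto
    moreover have "4 * C = u i * (4 * x) + u 1 * (4 * y) + u 3 * (4 * z)"
      using e(4) by (simp add: algebra_simps)
    ultimately show ?thesis by simp
  qed
  \<comment> \<open>The triple containing both tilted edges.\<close>
  have "6 * C = u 0 * (G 1 + 3 * G 2) + 9 * (u 1 * (G 0 + G 2)) + u 2 * (3 * G 0 + G 1)"
  proof -
    obtain x y z where e: "y / 3 + z - x = G 0" "3 * x + 3 * z - y = G 1" "x + y / 3 - z = G 2"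
      "u 0 * x + u 1 * y + u 2 * z = C"
      using sys[of 0 1 2] by (auto simp: skew_weight_def)
    have "6 * x = G 1 + 3 * G 2" "6 * y = 9 * (G 0 + G 2)" "6 * z = 3 * G 0 + G 1"
      using e(1-3) by auto
    moreover have "6 * C = u 0 * (6 * x) + u 1 * (6 * y) + u 2 * (6 * z)"
      using e(4) by (simp add: algebra_simps)
    ultimately show ?thesis by simp
  qed
  moreover have "G 0 = G 1 \<and> G 0 = G 2 \<and> u 0 = u 1 \<and> u 0 = u 2"
  proof (rule ccontr)
    assume neq: "\<not> ?thesis"
    \<comment> \<open>\<open>M\<close> is bilinear in the pairs \<open>(G i, u i)\<close>, so a nonzero difference of two of them is orthogonal
      to the pairs with indices 3, 4, 5; these are then parallel, hence equal.\<close>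
    have par: "(G 0 - G i) * u k + (u 0 - u i) * G k = 0" if "i \<in> {1,2}" "k \<in> {3,4,5}" for i k
    proof -
      have "M 0 k = 2*C/3" "M i k = 2*C/3"
        using that by (elim insertE emptyE; simp only: M M1)+
      then show ?thesis by (simp add: M_def algebra_simps)
    qed
    have "(G 0 \<noteq> G 1 \<or> u 0 \<noteq> u 1) \<or> (G 0 \<noteq> G 2 \<or> u 0 \<noteq> u 2)"
      using neq by blast
    then obtain i :: nat where i: "i \<in> {1,2}" "G 0 \<noteq> G i \<or> u 0 \<noteq> u i"
      by blast
    define g v where "g = G 3" and "v = u 3"
    have P: "G 4 = g" "u 4 = v"
      using parallel_pairs_equal[of "G 0 - G i" "u 0 - u i" "2*C/3" u G] i par[OF i(1)] C M(8-10)
      by (simp_all add: M_def g_def v_def)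
    have gv: "2 * g * v = 2*C/3" using M(8) P by (simp add: M_def g_def v_def)
    then have "g \<noteq> 0" "v \<noteq> 0" using C by auto
    \<comment> \<open>Relative deviation from the common vector \<open>(g, v)\<close> at 3, 4, 5.
      The values \<open>M i 3\<close> give \<open>u i = v * (1 - d i)\<close>, so the remaining
      equations become relations among \<open>d 0\<close>, \<open>d 1\<close> and
      \<open>d 2\<close>.\<close>
    define d where "d i = G i / g - 1" for i
    have G: "G i = g * (1 + d i)" for i using \<open>g \<noteq> 0\<close> by (simp add: d_def)
    have u: "u i = v * (1 - d i)" if "M i 3 = 2*C/3" for i
    proof -
      have "g * u i = g * (v * (1 - d i))"
        using that G[of i] gv by (simp add: M_def algebra_simps flip: g_def v_def)
      then show ?thesis using \<open>g \<noteq> 0\<close> by simp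
    qed
    note us = u[OF M(2)] u[OF M1(1)] u[OF M(5)]
    have C3: "C = 3 * (g * v)" using gv by simp
    have gv0: "g * v \<noteq> 0" using \<open>g \<noteq> 0\<close> \<open>v \<noteq> 0\<close> by simp
    have "g * v * (d 0 * d 2) = 0"
      using M(1) G[of 0] G[of 2] us C3 by (simp add: M_def algebra_simps)
    then have "d 0 = 0 \<or> d 2 = 0" using gv0 by simp
    moreover have "d i - d 1 = d i * d 1" if "i \<in> {0,2}" for i
    proof -
      have ui: "u i = v * (1 - d i)" using that us by auto
      have "4 * (3 * (g * v)) = v * (1 - d i) * (g * (1 + d 1) + g)
          + 3 * (v * (1 - d 1) * (g * (1 + d i) + g)) + v * (3 * (g * (1 + d i)) + g * (1 + d 1))"
        using skew[OF that] unfolding ui us(2) C3 G[of i] G[of 1] g_def[symmetric] v_def[symmetric] .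
      then have "g * v * (4 * d i - 4 * d 1 - 4 * (d i * d 1)) = 0"
        by (simp add: algebra_simps)
      then show ?thesis using gv0 by simp
    qed
    from this[of 0] this[of 2] have "d 0 - d 1 = d 0 * d 1" "d 2 - d 1 = d 2 * d 1" by auto
    \<comment> \<open>Whichever of \<open>d 0\<close> and \<open>d 2\<close> is 0, its relation
      yields \<open>d 1 = 0\<close>, and the other relation then settles the third.\<close>
    ultimately have "d 0 = 0" "d 1 = 0" "d 2 = 0" by auto
    then show False using neq us G[of 0] G[of 1] G[of 2] by simp
  qed
  ultimately have e: "6 * C = u 0 * (G 1 + 3 * G 2) + 9 * (u 1 * (G 0 + G 2)) + u 2 * (3 * G 0 + G 1)"
    and eq: "G 1 = G 0" "G 2 = G 0" "u 1 = u 0" "u 2 = u 0" by auto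
  \<comment> \<open>Since \<open>M 0 2\<close> gives \<open>G 0 * u 0 = C / 3\<close>, this would
    mean \<open>6 * C = 26 * C / 3\<close>.\<close>
  have "6 * C = 26 * (G 0 * u 0)" using e unfolding eq by (simp add: algebra_simps)
  moreover have "2 * (G 0 * u 0) = 2*C/3" using M(1) unfolding M_def eq by simp
  ultimately show False using C by linarith
qed

section \<open>The tilted polytope is not a facet\<close>

lemma weighted_pair_commute: "weighted_pair \<alpha> (j, i) = weighted_pair \<alpha> (i, j)"
  by (simp add: weighted_pair_def add.commute)

lemma weighted_pair_inject:
  assumes "\<And>i j. 0 < \<alpha> i j" "i \<noteq> j" "k \<noteq> l" "weighted_pair \<alpha> (i, j) = weighted_pair \<alpha> (k, l)"
  shows "{i, j} = {k, l}"
proof -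
  have "\<alpha> i j \<noteq> 0" for i j using assms(1)[of i j] by simp
  then have *: "{m. Poly_Mapping.lookup (weighted_pair \<alpha> (i, j)) m \<noteq> 0} = {i, j}" if "i \<noteq> j" for i j
    using that by (auto simp: lookup_weighted_pair)
  show ?thesis using *[OF assms(2)] *[OF assms(3)] assms(4) by simp
qed

text \<open>The vertex is cut out by \<open>x_l = 0\<close> for all other indices, the edge by a
  vanishing slack at the shared index \<open>i\<close> and \<open>x_l = 0\<close> outside
  \<open>i, j, k\<close>.\<close>

lemma weighted_pairs_faces:
  fixes \<alpha> :: "nat \<Rightarrow> nat \<Rightarrow> real"
  assumes \<alpha>: "\<And>i j. 0 < \<alpha> i j" "\<And>i j. i < n \<Longrightarrow> j < n \<Longrightarrow> i \<noteq> j \<Longrightarrow> \<alpha> i j + \<alpha> j i = 2"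
    and ijk: "i < n" "j < n" "k < n" "i \<noteq> j" "i \<noteq> k" "j \<noteq> k"
  shows "{weighted_pair \<alpha> (i, j)} face_of convex hull (weighted_pair \<alpha> ` distinct_pairs n)"
    "convex hull {weighted_pair \<alpha> (i, j), weighted_pair \<alpha> (i, k)} face_of
      convex hull (weighted_pair \<alpha> ` distinct_pairs n)"
proof -
  interpret described_polytope "distinct_pairs n" "UNIV \<times> {..<n}" "weighted_pair \<alpha>"
    "pair_constraint \<alpha> n" "{x. Poly_Mapping.keys x \<subseteq> {..<n} \<and> (\<Sum>i<n. Poly_Mapping.lookup x i) = 2}"
    using \<alpha> by (rule described_weighted_pairs)
  let ?K = "Pair True ` {l. l < n \<and> l \<noteq> i \<and> l \<noteq> j}"
  have "tight ?K = {q \<in> distinct_pairs n. \<forall>l<n. l \<noteq> i \<and> l \<noteq> j \<longrightarrow> l \<noteq> fst q \<and> l \<noteq> snd q}"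
    by (auto simp: tight_def pair_constraint_tight[OF \<alpha>(1)])
  also have "\<dots> = {(i, j), (j, i)}"
    using ijk by (auto simp: distinct_pairs_def) metis+
  finally have "tight ?K = {(i, j), (j, i)}" .
  then have "zero_face ?K = {weighted_pair \<alpha> (i, j)}"
    by (subst zero_face_hull) (auto simp: weighted_pair_commute[of \<alpha> j i])
  moreover have "zero_face ?K face_of P" by (rule zero_face_face_of) auto
  ultimately show "{weighted_pair \<alpha> (i, j)} face_of P" by simp
  let ?L = "insert (False, i) (Pair True ` {l. l < n \<and> l \<noteq> i \<and> l \<noteq> j \<and> l \<noteq> k})"
  have "tight ?L = {q \<in> distinct_pairs n. (i = fst q \<or> i = snd q) \<and>
      (\<forall>l<n. l \<noteq> i \<and> l \<noteq> j \<and> l \<noteq> k \<longrightarrow> l \<noteq> fst q \<and> l \<noteq> snd q)}"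
    by (auto simp: tight_def pair_constraint_tight[OF \<alpha>(1)])
  also have "\<dots> = {(i, j), (j, i), (i, k), (k, i)}" (is "?A = ?B")
  proof
    show "?A \<subseteq> ?B"
    proof
      fix q assume q: "q \<in> ?A"
      then have "fst q \<in> {i, j, k}" "snd q \<in> {i, j, k}" "fst q \<noteq> snd q"
        by (auto simp: distinct_pairs_def)
      with q show "q \<in> ?B" by (cases q) auto
    qed
    show "?B \<subseteq> ?A" using ijk by (auto simp: distinct_pairs_def)
  qed
  finally have "tight ?L = {(i, j), (j, i), (i, k), (k, i)}" .
  then have "zero_face ?L = convex hull {weighted_pair \<alpha> (i, j), weighted_pair \<alpha> (i, k)}"
    using ijk by (subst zero_face_hull)
      (auto simp: weighted_pair_commute[of \<alpha> j i] weighted_pair_commute[of \<alpha> k i])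
  moreover have "zero_face ?L face_of P" using ijk by (intro zero_face_face_of) auto
  ultimately show "convex hull {weighted_pair \<alpha> (i, j), weighted_pair \<alpha> (i, k)} face_of P" by simp
qed

lemma span_coordinate_differences:
  fixes z :: rvec
  assumes "Poly_Mapping.keys z \<subseteq> {..<n}" "(\<Sum>i<n. Poly_Mapping.lookup z i) = 0" "0 < n"
  shows "z \<in> span ((\<lambda>i. Poly_Mapping.single i 1 - Poly_Mapping.single 0 1) ` {1..<n})"
proof -
  have s: "{..<n} = insert 0 {1..<n}" using assms(3) by auto
  let ?e = "\<lambda>i. Poly_Mapping.single i 1 - Poly_Mapping.single 0 1 :: rvec"
  have "z = (\<Sum>i\<in>{1..<n}. Poly_Mapping.lookup z i *\<^sub>R ?e i)"
  proof (rule poly_mapping_eqI)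
    fix k
    have "Poly_Mapping.lookup (\<Sum>i\<in>{1..<n}. Poly_Mapping.lookup z i *\<^sub>R ?e i) k =
      (\<Sum>i\<in>{1..<n}. if k = 0 then - Poly_Mapping.lookup z i else if i = k then Poly_Mapping.lookup z i else 0)"
      unfolding lookup_sum
      by (rule sum.cong) (auto simp: lookup_scaleR lookup_minus lookup_single when_def simp del: single_one)
    also have "\<dots> = Poly_Mapping.lookup z k"
    proof (cases "k = 0")
      case True
      then show ?thesis using assms(2) by (simp add: s sum_negf)
    next
      case False
      then have "Poly_Mapping.lookup z k = 0" if "k \<notin> {1..<n}"
        using that assms(1) by (auto simp: in_keys_iff)
      then show ?thesis using False by (auto simp: sum.delta')
    qed
    finally show "Poly_Mapping.lookup z k =
      Poly_Mapping.lookup (\<Sum>i\<in>{1..<n}. Poly_Mapping.lookup z i *\<^sub>R ?e i) k" by simp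
  qed
  also have "\<dots> \<in> span (?e ` {1..<n})"
    by (intro span_sum span_scale span_base) auto
  finally show ?thesis .
qed

text \<open>Each relation reverses the sign, which is impossible around an odd cycle unless all
  values vanish. Hence an affine function with a zero inside each side of a triangle vanishes at its
  corners.\<close>

lemma triangle_zero:
  fixes a b c :: real
  assumes "0 < p" "0 < q" "0 < r" "0 < s" "0 < t" "0 < w"
    and "p * a + q * b = 0" "r * a + s * c = 0" "t * b + w * c = 0"
  shows "a = 0"
proof -
  have b: "b = - (p / q) * a" and c: "c = - (r / s) * a"
    using assms by (simp_all add: field_simps)
  have "- (t * (p / q) + w * (r / s)) * a = 0"
    using assms(9) unfolding b c by (simp add: algebra_simps)
  moreover have "0 < t * (p / q) + w * (r / s)" using assms(1-6) by (simp add: add_pos_pos)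
  ultimately show ?thesis by auto
qed

lemma skew_weight_pos: "0 < skew_weight i j"
  by (simp add: skew_weight_def)

lemma skew_weight_sum: "i \<noteq> j \<Longrightarrow> skew_weight i j + skew_weight j i = 2"
  by (auto simp: skew_weight_def)

definition skew_polytope :: "rvec set" where
  "skew_polytope = convex hull (weighted_pair skew_weight ` distinct_pairs 6)"

lemma skew_polytope_not_facet:
  fixes P F :: "'a::real_vector set"
  assumes P: "combinatorial_hypersimplex 7 3 P" and F: "is_facet F P"
    and iso: "affinely_isomorphic F skew_polytope"
  shows False
proof -
  let ?Q = skew_polytope and ?V = "hypersimplex_vertices 7 3"
  have poly: "polytope P" using P by (simp add: combinatorial_hypersimplex_def)
  have FP: "F face_of P" and Fne: "F \<noteq> {}" and Fdim: "affine_dim F = affine_dim P - 1"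
    using F by (auto simp: is_facet_def)
  have FsubP: "F \<subseteq> P" using FP by (rule face_of_imp_subset)
  have "affinely_isomorphic ?Q F"
    using iso face_of_imp_convex[OF FP] by (rule affinely_isomorphic_sym)
  then obtain f c where f: "linear f" and bij: "bij_betw (\<lambda>x. f x + c) ?Q F"
    by (auto simp: affinely_isomorphic_def)
  define T where "T = (\<lambda>x. f x + c)"
  have TQ: "T ` ?Q = F" and Tinj: "inj_on T ?Q"
    using bij by (auto simp: T_def bij_betw_def)

  \<comment> \<open>Bounding the dimension of \<open>P\<close>\<close>
  have "dim {x - y |x y. x \<in> F \<and> y \<in> F} \<le> 5"
  proof -
    let ?e = "\<lambda>i. Poly_Mapping.single i 1 - Poly_Mapping.single 0 1 :: rvec"
    interpret described_polytope "distinct_pairs 6" "UNIV \<times> {..<6}" "weighted_pair skew_weight"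
      "pair_constraint skew_weight 6" "{x. Poly_Mapping.keys x \<subseteq> {..<6} \<and> (\<Sum>i<6. Poly_Mapping.lookup x i) = 2}"
      by (rule described_weighted_pairs) (auto simp: skew_weight_pos skew_weight_sum)
    have Q: "Poly_Mapping.keys x \<subseteq> {..<6} \<and> (\<Sum>i<6. Poly_Mapping.lookup x i) = 2" if "x \<in> ?Q" for x
      using that hull_eq unfolding skew_polytope_def by blast
    have "{x - y |x y. x \<in> F \<and> y \<in> F} \<subseteq> span (f ` ?e ` {1..<6})"
    proof clarify
      fix x y assume "x \<in> F" "y \<in> F"
      then obtain p q where pq: "p \<in> ?Q" "q \<in> ?Q" "x = T p" "y = T q" using TQ by blast
      have "Poly_Mapping.keys (p - q) \<subseteq> {..<6}"
        using Q[OF pq(1)] Q[OF pq(2)] keys_diff[of p q] by blast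
      moreover have "(\<Sum>i<6. Poly_Mapping.lookup (p - q) i) = 0"
        using Q[OF pq(1)] Q[OF pq(2)] by (simp add: lookup_minus sum_subtractf)
      ultimately have "p - q \<in> span (?e ` {1..<6})" by (intro span_coordinate_differences) auto
      then have "f (p - q) \<in> span (f ` ?e ` {1..<6})"
        by (simp add: linear_span_image[OF f])
      then show "x - y \<in> span (f ` ?e ` {1..<6})"
        by (simp add: pq T_def linear_diff[OF f])
    qed
    then have "dim {x - y |x y. x \<in> F \<and> y \<in> F} \<le> card (f ` ?e ` {1..<6})"
      by (rule dim_le_card) simp
    also have "\<dots> \<le> card {1..<6::nat}"
      by (meson card_image_le finite_atLeastLessThan finite_imageI le_trans)
    finally show ?thesis by simp
  qed
  moreover have "P \<noteq> {}" using Fne FsubP by blast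
  ultimately have dim: "dim {x - y |x y. x \<in> P \<and> y \<in> P} \<le> DIM(real^6)"
    using Fdim Fne by (simp add: affine_dim_def)

  obtain v :: "nat set \<Rightarrow> 'a" and g h :: "nat \<Rightarrow> 'a \<Rightarrow> real" where
    v: "\<And>S. S \<in> ?V \<Longrightarrow> {v S} face_of P" "inj_on v ?V" "\<And>x. {x} face_of P \<Longrightarrow> x \<in> v ` ?V"
    and exch: "\<And>G S T i j. G face_of P \<Longrightarrow> S \<in> ?V \<Longrightarrow> T \<in> ?V \<Longrightarrow>
      v S \<in> G \<Longrightarrow> v T \<in> G \<Longrightarrow> i \<in> S - T \<Longrightarrow> j \<in> T - S \<Longrightarrow>
      insert j (S - {i}) \<in> ?V \<and> v (insert j (S - {i})) \<in> G"
    and g: "\<And>i. affine_fun (g i)" "\<And>i x. x \<in> P \<Longrightarrow> 0 \<le> g i x"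
      "\<And>i S. S \<in> ?V \<Longrightarrow> g i (v S) = 0 \<longleftrightarrow> i \<in> S"
    and h: "\<And>i. affine_fun (h i)" "\<And>i x. x \<in> P \<Longrightarrow> 0 \<le> h i x"
      "\<And>i S. S \<in> ?V \<Longrightarrow> h i (v S) = 0 \<longleftrightarrow> i \<notin> S"
    by (rule combinatorial_hypersimplex_structure[OF P dim]) (rule that)
  have vP: "v S \<in> P" if "S \<in> ?V" for S
    using v(1)[OF that] face_of_imp_subset by blast

  \<comment> \<open>Labelling the vertices of the facet by 3-subsets\<close>
  define b where "b i j = T (weighted_pair skew_weight (i, j))" for i j
  have Tface: "T ` G face_of P" if "G face_of ?Q" for G
  proof -
    have "T ` G face_of T ` ?Q"
      unfolding T_def
      by (rule face_of_affine_image[OF f _ _ that])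
         (use Tinj in \<open>simp_all add: T_def skew_polytope_def\<close>)
    then show ?thesis using FP face_of_trans unfolding TQ by blast
  qed
  have wQ: "weighted_pair skew_weight (i, j) \<in> ?Q" if "i < 6" "j < 6" "i \<noteq> j" for i j
    using that by (auto simp: skew_polytope_def distinct_pairs_def intro: hull_inc)
  have bF: "b i j \<in> F" if "i < 6" "j < 6" "i \<noteq> j" for i j
    using wQ[OF that] TQ by (auto simp: b_def)
  have edge: "{b i j} face_of P" "convex hull {b i j, b i k} face_of P"
    if ijk: "i < 6" "j < 6" "k < 6" "i \<noteq> j" "i \<noteq> k" "j \<noteq> k" for i j k
  proof -
    have "T ` (convex hull {weighted_pair skew_weight (i, j), weighted_pair skew_weight (i, k)}) = convex hull {b i j, b i k}"
      unfolding T_def affine_image_convex_hull[OF f] by (simp add: b_def T_def)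
    then show "{b i j} face_of P" "convex hull {b i j, b i k} face_of P"
      using Tface[OF weighted_pairs_faces(1)[of skew_weight 6 i j k, folded skew_polytope_def]]
        Tface[OF weighted_pairs_faces(2)[of skew_weight 6 i j k, folded skew_polytope_def]] ijk
      by (simp_all add: skew_weight_pos skew_weight_sum b_def)
  qed
  have "\<exists>S\<in>?V. v S = b i j" if ij: "i < 6" "j < 6" "i \<noteq> j" for i j
  proof -
    have "\<not> {..<6::nat} \<subseteq> {i, j}"
      using card_mono[of "{i, j}" "{..<6::nat}"] card_insert_le_m1[of 2 "{j}" i] by auto
    then obtain k where "k < 6" "i \<noteq> k" "j \<noteq> k" by auto
    then have "{b i j} face_of P" using edge(1) ij by blast
    then have "b i j \<in> v ` ?V" by (rule v(3))
    then show ?thesis by (elim imageE) auto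
  qed
  then obtain s where s: "\<And>i j. i < 6 \<Longrightarrow> j < 6 \<Longrightarrow> i \<noteq> j \<Longrightarrow> s i j \<in> ?V \<and> v (s i j) = b i j"
    by metis
  have scomm: "s i j = s j i" if "i < 6" "j < 6" "i \<noteq> j" for i j
  proof (rule inj_onD[OF v(2)])
    show "v (s i j) = v (s j i)"
      using s[OF that] s[of j i] that weighted_pair_commute[of skew_weight j i] by (simp add: b_def)
  qed (use s that in auto)
  have sinj: "{i, j} = {k, l}"
    if "i < 6" "j < 6" "k < 6" "l < 6" "i \<noteq> j" "k \<noteq> l" "s i j = s k l" for i j k l
  proof -
    have "T (weighted_pair skew_weight (i, j)) = T (weighted_pair skew_weight (k, l))"
      using s[of i j] s[of k l] that by (simp add: b_def)
    then have "weighted_pair skew_weight (i, j) = weighted_pair skew_weight (k, l)"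
      using Tinj wQ that by (auto dest: inj_onD)
    then show ?thesis using weighted_pair_inject skew_weight_pos that by blast
  qed
  \<comment> \<open>Labels of vertices joined by an edge differ by one swap: otherwise the exchange
    property yields a third vertex on the edge, whose only extreme points are its ends.\<close>
  have adj: "card (s i j \<inter> s i k) = 2"
    if ijk: "i < 6" "j < 6" "k < 6" "i \<noteq> j" "i \<noteq> k" "j \<noteq> k" for i j k
  proof (rule ccontr)
    define A B where "A = s i j" and "B = s i k"
    assume "card (s i j \<inter> s i k) \<noteq> 2"
    then have n2: "card (A \<inter> B) \<noteq> 2" by (simp add: A_def B_def)
    have A: "A \<in> ?V" "v A = b i j" and B: "B \<in> ?V" "v B = b i k"
      using s ijk by (auto simp: A_def B_def)
    have fin: "finite A" "finite B" and cA: "card A = 3" and cB: "card B = 3"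
      using hypersimplex_vertices_finite[OF A(1)] hypersimplex_vertices_finite[OF B(1)] A(1) B(1)
      by (simp_all add: hypersimplex_vertices_def)
    have "A \<noteq> B"
      using sinj[of i j i k] ijk unfolding A_def B_def by (auto simp: doubleton_eq_iff)
    then have "\<not> A \<subseteq> B" using card_subset_eq[OF fin(2), of A] cA cB by auto
    then have "A \<inter> B \<subset> A" by blast
    then have "card (A \<inter> B) < 3" using psubset_card_mono[OF fin(1)] cA by metis
    then have "card (A \<inter> B) \<le> 1" using n2 by simp
    then have dA: "2 \<le> card (A - B)" and dB: "2 \<le> card (B - A)"
      using card_Diff_subset_Int[of A B] card_Diff_subset_Int[of B A] fin cA cB
      by (auto simp: Int_commute)
    have "\<not> card (A - B) \<le> Suc 0" using dA by simp
    then obtain p q where pq: "p \<in> A - B" "q \<in> A - B" "p \<noteq> q"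
      using card_le_Suc0_iff_eq[of "A - B"] fin by blast
    have "B - A \<noteq> {}" using dB by (metis card.empty not_numeral_le_zero)
    then obtain r where r: "r \<in> B - A" by blast
    let ?C = "insert r (A - {p})"
    have C: "?C \<in> ?V \<and> v ?C \<in> convex hull {b i j, b i k}"
      by (rule exch[OF edge(2)[OF ijk] A(1) B(1) _ _ pq(1) r]) (simp_all add: A B hull_inc)
    then have "v ?C extreme_point_of convex hull {b i j, b i k}"
      using v(1)[of ?C] face_of_subset[of "{v ?C}" P "convex hull {b i j, b i k}"]
        face_of_imp_subset[OF edge(2)[OF ijk]] by (auto simp: face_of_singleton)
    then have "v ?C \<in> {b i j, b i k}" by (rule extreme_point_of_convex_hull)
    then have "v ?C = v A \<or> v ?C = v B" using A B by auto
    then have "?C = A \<or> ?C = B" using A(1) B(1) C by (auto dest: inj_onD[OF v(2)])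
    then show False using pq r by blast
  qed
  \<comment> \<open>The facet is thus of type \<open>x_z = 1\<close>: all its labels contain
    \<open>z\<close>, and \<pi> names the other six indices.\<close>
  obtain z \<pi> where z: "z < 7" and \<pi>inj: "inj_on \<pi> {..<6}" and \<pi>: "\<And>i. i < 6 \<Longrightarrow> \<pi> i < 7 \<and> \<pi> i \<noteq> z"
    and lab: "\<And>i j. i < 6 \<Longrightarrow> j < 6 \<Longrightarrow> i \<noteq> j \<Longrightarrow> s i j = {z, \<pi> i, \<pi> j}"
  proof (rule triangular_labelling[of s])
    show "s i j \<subseteq> {..<7} \<and> card (s i j) = 3 \<and> s i j = s j i" if "i < 6" "j < 6" "i \<noteq> j" for i j
      using s[OF that] scomm[OF that] by (simp add: hypersimplex_vertices_def)
    show "{i, j} = {k, l}"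
      if "i < 6" "j < 6" "k < 6" "l < 6" "i \<noteq> j" "k \<noteq> l" "s i j = s k l" for i j k l
      by (rule sinj[OF that])
    show "card (s i j \<inter> s i k) = 2"
      if "i < 6" "j < 6" "k < 6" "i \<noteq> j" "i \<noteq> k" "j \<noteq> k" for i j k
      by (rule adj[OF that])
  qed (rule that)
  have \<pi>eq: "\<pi> i = \<pi> j \<longleftrightarrow> i = j" if "i < 6" "j < 6" for i j
    using \<pi>inj that by (auto simp: inj_on_def)

  \<comment> \<open>Coordinates on the affine hull of \<open>P\<close>\<close>
  define E where "E i = T (Poly_Mapping.single i 2)" for i
  \<comment> \<open>\<open>E i\<close> is the image of the simplex vertex with entry 2 at
    \<open>i\<close>, and \<open>b i j\<close> divides the segment from \<open>E i\<close> to
    \<open>E j\<close> according to the weights. On the facet an affine function is therefore known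
    from its six values at the \<open>E i\<close>.\<close>
  have bE: "\<phi> (b i j) = (skew_weight i j / 2) * \<phi> (E i) + (skew_weight j i / 2) * \<phi> (E j)"
    if \<phi>: "affine_fun \<phi>" and "i \<noteq> j" for \<phi> i j
  proof -
    have "weighted_pair skew_weight (i, j) = (skew_weight i j / 2) *\<^sub>R Poly_Mapping.single i 2 + (skew_weight j i / 2) *\<^sub>R Poly_Mapping.single j 2"
      by (rule poly_mapping_eqI)
         (simp add: weighted_pair_def lookup_add lookup_scaleR lookup_single when_def)
    moreover have sum1: "skew_weight i j / 2 + skew_weight j i / 2 = 1" using skew_weight_sum[OF that(2)] by simp
    ultimately have "b i j = (skew_weight i j / 2) *\<^sub>R E i + (skew_weight j i / 2) *\<^sub>R E j"
      unfolding b_def E_def T_def using affine_image_comb[OF f sum1] by simp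
    then show ?thesis using affine_fun_comb[OF \<phi> sum1] by simp
  qed
  define H G where "H i = h (\<pi> i)" and "G i = g (\<pi> i)" for i
  have Haff: "affine_fun (H i)" and Gaff: "affine_fun (G i)" for i
    by (simp_all add: H_def G_def h g)
  have bP: "b i j \<in> P" if "i < 6" "j < 6" "i \<noteq> j" for i j using bF[OF that] FsubP by blast
  have Hb: "H l (b i j) = 0 \<longleftrightarrow> l \<noteq> i \<and> l \<noteq> j" and Gb: "G l (b i j) = 0 \<longleftrightarrow> l = i \<or> l = j"
    and hzb: "h z (b i j) \<noteq> 0" and gzb: "g z (b i j) = 0"
    if ij: "i < 6" "j < 6" "i \<noteq> j" and l: "l < 6" for i j l
  proof -
    have S: "{z, \<pi> i, \<pi> j} \<in> ?V" "b i j = v {z, \<pi> i, \<pi> j}"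
      using s[OF ij] lab[OF ij] by auto
    show "H l (b i j) = 0 \<longleftrightarrow> l \<noteq> i \<and> l \<noteq> j" "G l (b i j) = 0 \<longleftrightarrow> l = i \<or> l = j"
      "h z (b i j) \<noteq> 0" "g z (b i j) = 0"
      unfolding S(2) H_def G_def h(3)[OF S(1)] g(3)[OF S(1)]
      using \<pi>eq[OF l ij(1)] \<pi>eq[OF l ij(2)] \<pi>[OF l] by auto
  qed
  have zero_at_E: "\<phi> (E j) = 0"
    if \<phi>: "affine_fun \<phi>" and jkl: "j \<noteq> k" "j \<noteq> l" "k \<noteq> l"
      and 0: "\<phi> (b j k) = 0" "\<phi> (b j l) = 0" "\<phi> (b k l) = 0" for \<phi> j k l
    by (rule triangle_zero[OF _ _ _ _ _ _ 0[unfolded bE[OF \<phi> jkl(1)] bE[OF \<phi> jkl(2)] bE[OF \<phi> jkl(3)]]])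
       (simp_all add: skew_weight_pos)
  have avoid: "\<exists>k l. k < 6 \<and> l < 6 \<and> k \<noteq> l \<and> k \<notin> {i, j} \<and> l \<notin> {i, j}" for i j :: nat
  proof -
    have "card {i, j} \<le> 2" by (rule card_insert_le_m1) auto
    then have "4 \<le> card ({..<6} - {i, j})" using diff_card_le_card_Diff[of "{i, j}" "{..<6}"] by simp
    then obtain k l where "k \<in> {..<6} - {i, j}" "l \<in> {..<6} - {i, j}" "k \<noteq> l"
      using card_le_Suc0_iff_eq[of "{..<6} - {i, j}"] by auto
    then show ?thesis by blast
  qed
  \<comment> \<open>A triangle on \<open>j\<close>, \<open>k\<close>, \<open>l\<close> avoiding
    \<open>i\<close> has zeros of \<open>H i\<close> on its three sides, so
    \<open>triangle_zero\<close> applies. Up to positive scaling the \<open>H i\<close> are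
    barycentric coordinates with respect to the \<open>E i\<close>.\<close>
  have HE0: "H i (E j) = 0" if "i < 6" "j < 6" "i \<noteq> j" for i j
  proof -
    obtain k l where "k < 6" "l < 6" "k \<noteq> l" "k \<notin> {i, j}" "l \<notin> {i, j}" using avoid by blast
    then show ?thesis using that by (intro zero_at_E[of "H i" j k l] Haff) (auto simp: Hb)
  qed
  have gzE: "g z (E j) = 0" if "j < 6" for j
  proof -
    obtain k l where "k < 6" "l < 6" "k \<noteq> l" "k \<notin> {j, j}" "l \<notin> {j, j}" using avoid by blast
    then show ?thesis using that gzb by (intro zero_at_E[of "g z" j k l] g) auto
  qed
  have HEpos: "0 < H i (E i)" if "i < 6" for i
  proof -
    obtain j where j: "j < 6" "i \<noteq> j" using avoid[of i i] by blast
    have "0 < H i (b i j)"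
      using Hb[of i j i] h(2)[OF bP[of i j]] that j by (simp add: H_def order_less_le)
    then show ?thesis
      using bE[OF Haff j(2)] HE0[of i j] that j skew_weight_pos[of i j] by (simp add: zero_less_mult_iff)
  qed
  \<comment> \<open>As \<open>G i\<close> vanishes at each \<open>b i j\<close>, the weights
    determine its values at all \<open>E j\<close> up to one factor. Here the shape of the facet
    enters.\<close>
  have GE: "G i (E j) = - (skew_weight i j / skew_weight j i) * G i (E i)" if "i < 6" "j < 6" "i \<noteq> j" for i j
  proof -
    have "skew_weight i j * G i (E i) + skew_weight j i * G i (E j) = 0"
      using Gb[of i j i] bE[OF Gaff that(3), of i] that by simp
    then show ?thesis using skew_weight_pos[of j i] by (simp add: field_simps)
  qed
  have GEne: "G i (E i) \<noteq> 0" if "i < 6" for i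
  proof
    assume 0: "G i (E i) = 0"
    obtain j k where jk: "j < 6" "k < 6" "j \<noteq> k" "j \<notin> {i, i}" "k \<notin> {i, i}" using avoid by blast
    then have "G i (b j k) = 0" using bE[OF Gaff jk(3)] GE that 0 by simp
    then show False using Gb[of j k i] jk that by auto
  qed

  \<comment> \<open>A reference vertex off the facet; together with \<open>F\<close> it spans the
    affine hull of \<open>P\<close>.\<close>
  define S0 where "S0 = {\<pi> 0, \<pi> 1, \<pi> 2}"
  have triple: "{\<pi> i, \<pi> j, \<pi> k} \<in> ?V" "g z (v {\<pi> i, \<pi> j, \<pi> k}) > 0"
    if "i < 6" "j < 6" "k < 6" "i \<noteq> j" "i \<noteq> k" "j \<noteq> k" for i j k
  proof -
    show S: "{\<pi> i, \<pi> j, \<pi> k} \<in> ?V"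
      using that \<pi> \<pi>eq by (auto simp: hypersimplex_vertices_def)
    have "z \<notin> {\<pi> i, \<pi> j, \<pi> k}" using that \<pi> by auto
    then show "g z (v {\<pi> i, \<pi> j, \<pi> k}) > 0"
      using g(3)[OF S] g(2)[OF vP[OF S], of z] by (simp add: order_less_le)
  qed
  have S0: "S0 \<in> ?V" "g z (v S0) > 0" using triple[of 0 1 2] by (simp_all add: S0_def)
  have zeroF: "\<psi> x = 0" if \<psi>: "affine_fun \<psi>" "\<And>i. i < 6 \<Longrightarrow> \<psi> (E i) = 0" and x: "x \<in> F" for \<psi> x
  proof -
    have "x \<in> T ` ?Q" using x TQ by simp
    also have "T ` ?Q = convex hull (T ` weighted_pair skew_weight ` distinct_pairs 6)"
      unfolding skew_polytope_def T_def by (rule affine_image_convex_hull[OF f])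
    finally have "x \<in> affine hull (T ` weighted_pair skew_weight ` distinct_pairs 6)"
      using convex_hull_subset_affine_hull by blast
    then show ?thesis
    proof (rule affine_fun_zero_hull[OF \<psi>(1), rotated])
      fix y assume "y \<in> T ` weighted_pair skew_weight ` distinct_pairs 6"
      then obtain i j where "y = b i j" "i < 6" "j < 6" "i \<noteq> j"
        by (auto simp: distinct_pairs_def b_def)
      then show "\<psi> y = 0" using bE[OF \<psi>(1)] \<psi>(2) by simp
    qed
  qed
  have gzF: "g z x = 0" if "x \<in> F" for x by (rule zeroF[OF g(1) gzE that])
  have PA: "P \<subseteq> affine hull (insert (v S0) F)"
    using S0 gzF[of "v S0"] by (intro facet_affine_hull[OF poly F] vP) auto
  \<comment> \<open>The coefficient of \<open>g z\<close>, chosen to make the expansion below exact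
    at \<open>v S0\<close>.\<close>
  define \<kappa> where "\<kappa> \<phi> = (\<phi> (v S0) - (\<Sum>i<6. \<phi> (E i) / H i (E i) * H i (v S0))) / g z (v S0)" for \<phi>
  have repr: "\<phi> x = (\<Sum>i<6. \<phi> (E i) / H i (E i) * H i x) + \<kappa> \<phi> * g z x"
    if \<phi>: "affine_fun \<phi>" and x: "x \<in> P" for \<phi> x
  proof -
    \<comment> \<open>The error of the expansion vanishes at all \<open>E i\<close>, hence on
      \<open>F\<close>, and also at \<open>v S0\<close>; \<open>facet_affine_hull\<close> extends
      this to \<open>P\<close>.\<close>
    define \<psi> where "\<psi> x = \<phi> x - ((\<Sum>i<6. \<phi> (E i) / H i (E i) * H i x) + \<kappa> \<phi> * g z x)" for x
    have aff: "affine_fun \<psi>"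
      unfolding \<psi>_def
      by (intro affine_fun_diff affine_fun_add affine_fun_sum_fun affine_fun_mult \<phi> Haff g)
    have "\<psi> (E j) = 0" if j: "j < 6" for j
    proof -
      have "(\<Sum>i<6. \<phi> (E i) / H i (E i) * H i (E j)) = (\<Sum>i<6. if i = j then \<phi> (E j) else 0)"
        using HE0 HEpos[OF j] j by (intro sum.cong) auto
      also have "\<dots> = \<phi> (E j)" using j by simp
      finally show ?thesis using gzE[OF j] by (simp add: \<psi>_def)
    qed
    then have "\<psi> y = 0" if "y \<in> F" for y by (rule zeroF[OF aff _ that])
    moreover have "\<psi> (v S0) = 0" using S0 by (simp add: \<psi>_def \<kappa>_def)
    ultimately have "\<psi> y = 0" if "y \<in> insert (v S0) F" for y using that by blast
    then have "\<psi> x = 0"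
      by (rule affine_fun_zero_hull[OF aff _ subsetD[OF PA x]])
    then show ?thesis by (simp add: \<psi>_def)
  qed

  \<comment> \<open>The equations at the vertices off the facet\<close>
  show False
  \<comment> \<open>The unknowns are the normalized coefficient of \<open>g z\<close> in each
    \<open>G i\<close>, the values of \<open>h z\<close> at the \<open>E i\<close>, and minus the
    coefficient of \<open>g z\<close> in \<open>h z\<close>.\<close>
  proof (rule weighted_system_infeasible[of "\<lambda>i. \<kappa> (G i) / G i (E i)" "\<lambda>i. h z (E i)" "- \<kappa> (h z)"])
    fix i j k :: nat
    assume ijk: "i < 6" "j < 6" "k < 6" "i \<noteq> j" "i \<noteq> k" "j \<noteq> k"
    \<comment> \<open>At this vertex \<open>G i\<close>, \<open>G j\<close>, \<open>G k\<close> and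
      \<open>h z\<close> vanish, giving the four equations. The \<open>H l\<close> with
      \<open>l\<close> outside \<open>i, j, k\<close> vanish too, which leaves three positive
      coordinates.\<close>
    define S X where "S = {\<pi> i, \<pi> j, \<pi> k}" and "X = v S"
    have S: "S \<in> ?V" and Zpos: "0 < g z X" using triple[OF ijk] by (simp_all add: S_def X_def)
    have XP: "X \<in> P" unfolding X_def by (rule vP[OF S])
    have HX: "H l X = 0 \<longleftrightarrow> l \<notin> {i, j, k}" if l: "l < 6" for l
      unfolding H_def X_def h(3)[OF S] using \<pi>eq[OF l] ijk by (simp add: S_def)
    \<comment> \<open>Normalized so that \<open>E l\<close> has coordinate 1 and the factor
      \<open>g z X\<close> drops out of the expansion.\<close>
    define y where "y l = H l X / H l (E l) / g z X" for l
    have ypos: "0 < y l" if l: "l \<in> {i, j, k}" for l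
    proof -
      have "l < 6" using l ijk by auto
      then have "0 < H l X" using HX l h(2)[OF XP] by (metis H_def order_less_le)
      then show ?thesis using HEpos[OF \<open>l < 6\<close>] Zpos by (simp add: y_def)
    qed
    have eq: "\<phi> (E i) * y i + \<phi> (E j) * y j + \<phi> (E k) * y k + \<kappa> \<phi> = \<phi> X / g z X"
      if \<phi>: "affine_fun \<phi>" for \<phi>
    proof -
      have "(\<Sum>l<6. \<phi> (E l) / H l (E l) * H l X) = (\<Sum>l\<in>{i, j, k}. \<phi> (E l) / H l (E l) * H l X)"
        using ijk HX by (intro sum.mono_neutral_right) auto
      also have "\<dots> = (\<Sum>l\<in>{i, j, k}. \<phi> (E l) * y l * g z X)"
        using Zpos by (intro sum.cong) (auto simp: y_def)
      also have "\<dots> = (\<phi> (E i) * y i + \<phi> (E j) * y j + \<phi> (E k) * y k) * g z X"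
        using ijk by (simp add: distrib_right)
      finally have "\<phi> X = (\<phi> (E i) * y i + \<phi> (E j) * y j + \<phi> (E k) * y k) * g z X + \<kappa> \<phi> * g z X"
        using repr[OF \<phi> XP] by simp
      then show ?thesis using Zpos by (simp add: field_simps)
    qed
    have GX: "G l X = 0" if "l \<in> {i, j, k}" for l
      unfolding G_def X_def g(3)[OF S] using that by (auto simp: S_def)
    have hzX: "h z X = 0"
      unfolding X_def h(3)[OF S] using \<pi> ijk by (auto simp: S_def)
    \<comment> \<open>The equation \<open>G p X = 0\<close> divided by \<open>G p (E p)\<close>,
      whose sign is irrelevant for an equation.\<close>
    have row: "skew_weight p q / skew_weight q p * y q + skew_weight p r / skew_weight r p * y r - y p = \<kappa> (G p) / G p (E p)"
      if e: "G p (E p) * y p + G p (E q) * y q + G p (E r) * y r + \<kappa> (G p) = 0"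
        and "p < 6" "q < 6" "r < 6" "p \<noteq> q" "p \<noteq> r" for p q r
    proof -
      have "G p (E p) * (skew_weight p q / skew_weight q p * y q + skew_weight p r / skew_weight r p * y r - y p) = \<kappa> (G p)"
        using e unfolding GE[OF that(2,3,5)] GE[OF that(2,4,6)] by (simp add: algebra_simps)
      then show ?thesis using GEne[OF that(2)] by (simp add: field_simps)
    qed
    have "skew_weight i j / skew_weight j i * y j + skew_weight i k / skew_weight k i * y k - y i = \<kappa> (G i) / G i (E i)"
      using eq[OF Gaff, of i] GX[of i] ijk by (intro row) simp_all
    moreover have "skew_weight j i / skew_weight i j * y i + skew_weight j k / skew_weight k j * y k - y j = \<kappa> (G j) / G j (E j)"
      using eq[OF Gaff, of j] GX[of j] ijk by (intro row) simp_all
    moreover have "skew_weight k i / skew_weight i k * y i + skew_weight k j / skew_weight j k * y j - y k = \<kappa> (G k) / G k (E k)"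
      using eq[OF Gaff, of k] GX[of k] ijk by (intro row) simp_all
    moreover have "h z (E i) * y i + h z (E j) * y j + h z (E k) * y k = - \<kappa> (h z)"
      using eq[OF h(1), of z] hzX by simp
    ultimately show "\<exists>x y z'. 0 < x \<and> 0 < y \<and> 0 < z' \<and>
        skew_weight i j / skew_weight j i * y + skew_weight i k / skew_weight k i * z' - x = \<kappa> (G i) / G i (E i) \<and>
        skew_weight j i / skew_weight i j * x + skew_weight j k / skew_weight k j * z' - y = \<kappa> (G j) / G j (E j) \<and>
        skew_weight k i / skew_weight i k * x + skew_weight k j / skew_weight j k * y - z' = \<kappa> (G k) / G k (E k) \<and>
        h z (E i) * x + h z (E j) * y + h z (E k) * z' = - \<kappa> (h z)"
      using ypos by (intro exI[of _ "y i"] exI[of _ "y j"] exI[of _ "y k"]) simp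
  next
    fix i j :: nat
    assume ij: "i < 6" "j < 6" "i \<noteq> j"
    \<comment> \<open>\<open>h z\<close> is nonnegative on \<open>P\<close> and nonzero at vertices
      whose label contains \<open>z\<close>; expanding by \<open>bE\<close> gives the positivity
      condition.\<close>
    have "0 < h z (b i j)" using hzb[OF ij ij(1)] h(2)[OF bP[OF ij], of z] by simp
    then show "0 < skew_weight i j * h z (E i) + skew_weight j i * h z (E j)"
      using bE[OF h(1) ij(3), of z] by simp
  qed
qed

theorem corollary5p3:
  shows "\<exists>n k :: nat. 0 < k \<and> k < n \<and>
    (\<exists>Q :: rvec set. combinatorial_hypersimplex n k Q \<and>
      \<not> (\<exists>P F :: rvec set. combinatorial_hypersimplex (n + 1) (k + 1) P \<and>
            is_facet F P \<and> affinely_isomorphic F Q))"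
proof (rule exI[of _ 6], rule exI[of _ 2], intro conjI exI[of _ skew_polytope] notI)
  show "combinatorial_hypersimplex 6 2 skew_polytope"
    unfolding skew_polytope_def
    by (rule combinatorial_hypersimplex_weighted_pairs) (auto simp: skew_weight_pos skew_weight_sum)
next
  assume "\<exists>P F :: rvec set. combinatorial_hypersimplex (6 + 1) (2 + 1) P \<and>
            is_facet F P \<and> affinely_isomorphic F skew_polytope"
  then obtain P F :: "rvec set" where "combinatorial_hypersimplex 7 3 P" "is_facet F P"
    "affinely_isomorphic F skew_polytope" by auto
  then show False by (rule skew_polytope_not_facet)
qed auto

end
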